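(* Let $G$ be a discrete countable group and $\boldsymbol{\sigma}$ an $\boldsymbol{\ell}$-stochastic sequence on $G$ such that $\sigma^{(0)}_{0,j}$ is supported on all of $G$ for every $j\in[\ell_0]$ and no $\sigma^{(n)}$ has a zero column. Let $\mathcal{X}$ be a regular $\boldsymbol{\sigma}$-system, and let $\Lambda(\mathcal{X})$ be a proximal $\boldsymbol{\sigma}$-system having $\Pi(\mathcal{X})$ as a factor. Consider the joining $\mathcal{X}^*=\mathcal{X}\curlyvee\Lambda(\mathcal{X})$. Then: 1. The projection $\mathcal{X}^*\to\mathcal{X}$ is a proximal extension. 2. The projection $\mathcal{X}^*\to\Lambda(\mathcal{X})$ is a measure preserving extension.
   Context: Stochastic sequences. $[\ell]=\{0,\dots,\ell-1\}$. Let $\boldsymbol{\ell}=(\ell_n)_{n\ge0}$ be positive integers, $\ell_{-1}=1$. An $\boldsymbol{\ell}$-stochastic sequence is $\boldsymbol{\sigma}=(\sigma^{(n)})_{n\ge0}$, $\sigma^{(n)}=(\sigma^{(n)}_{i,j})_{i\in[\ell_{n-1}],j\in[\ell_n]}$ a matrix of non-negative measures on $G$ with $\sum_j\sigma^{(n)}_{i,j}(G)=1$ for each $i$. No zero column: for all $n$, $j\in[\ell_n]$ there is $i$ with $\sigma^{(n)}_{i,j}(G)>0$. For $\mu$ on $G$ and $\nu$ on a $G$-space, $\mu*\nu=\sum_g\mu(g)\,g\nu$, and $(\sigma*\nu)_i=\sum_j\sigma_{i,j}*\nu_j$. $\boldsymbol{\sigma}$-systems. A $\boldsymbol{\sigma}$-system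 (or $\boldsymbol{\sigma}$-stationary space) $(X,\Sigma,\boldsymbol{\nu})$ is a measurable space with a measurable $G$-action and $\boldsymbol{\nu}=(\nu^{(n)})_{n\ge-1}$, $\nu^{(n)}=(\nu^{(n)}_j)_{j\in[\ell_n]}$ columns of probability measures with $\sigma^{(n)}*\nu^{(n)}=\nu^{(n-1)}$ for $n\ge0$. Null sets refer to $\nu^{(-1)}$. It is regular if $(X,\Sigma)$ is standard Borel. A factor $\pi:(X,\boldsymbol{\nu})\to(Y,\boldsymbol{m})$ is a measurable $G$-map with $\pi_*\nu^{(n)}_j=m^{(n)}_j$ (then $\mathcal{X}$ is an extension of $\mathcal{Y}$); it is a measure preserving extension if $\frac{dg\nu^{(n)}_i}{d\nu^{(-1)}}=\frac{dg m^{(n)}_i}{dm^{(-1)}}\circ\pi$ for all $n,i,g$. Poisson boundary. $V_n=[\ell_n]\times G$ with $G$ acting by left translation on the second coordinate, $\Omega=\prod_{n\ge0}V_n$ with coordinates $X_n$, $\mathbb{P}$ the Markov measure with initial distribution $\sigma^{(0)}$ and transition probabilities $(i,g)\to(j,h)$ from $V_{n-1}$ to $V_n$ equal to $\sigma^{(n)}_{i,j}(g^{-1}h)$; $\mathcal{A}_\Omega=\bigcap_m\sigma(X_k:k\ge m)$; $\mathbb{P}^{(m)}_j$ is the law on $\sigma(X_k:k\ge m)$ of the same walk started at $(j,e)\in V_m$ at time $m$, $\mathbb{P}^{(-1)}=\mathbb{P}$. The Poisson boundary $\mathcal{B}(G,\boldsymbol{\sigma})=(B,\boldsymbol{m})$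 is the (unique up to isomorphism) $\boldsymbol{\sigma}$-system on a standard Borel space with a $G$-equivariant isomorphism $L^\infty(B,m^{(-1)})\cong L^\infty(\Omega,\mathcal{A}_\Omega,\mathbb{P})$ under which $m^{(n)}_j$ corresponds to $\mathbb{P}^{(n)}_j$. Conditional measures. For a regular $\boldsymbol{\sigma}$-system $\mathcal{X}=(X,\Sigma_X,\boldsymbol{\nu})$, $M(X,\Sigma_X)$ is the Borel $G$-space of probability measures on $(X,\Sigma_X)$, and $\Phi_X:B\to M(X,\Sigma_X)$ is the unique (up to a.e. equality) measurable $G$-map with $g\nu^{(n)}_j=\int_B\Phi_X\,d(gm^{(n)}_j)$ for all $n\ge-1$, $j\in[\ell_n]$, $g\in G$. Define $\Pi(\mathcal{X})=(M(X,\Sigma_X),(\Phi_X)_*\boldsymbol{m})$. Proximality. A factor $\pi:\mathcal{X}\to\mathcal{Y}$ of regular $\boldsymbol{\sigma}$-systems is proximal if for a.e. $b\in B$ the map $\pi:(X,\Phi_X(b))\to(Y,\Phi_Y(b))$ is an isomorphism modulo null sets. A regular $\boldsymbol{\sigma}$-system is proximal if its map to a point is proximal (equivalently, $\Phi_X(b)$ is a delta measure for a.e. $b$). Joining. For regular $\mathcal{X}=(X,\boldsymbol{\nu})$, $\mathcal{Y}=(Y,\boldsymbol{\kappa})$, $\mathcal{X}\curlyvee\mathcal{Y}=(X\times Y,\boldsymbol{\rho})$ with diagonal action and $\rho^{(n)}=\int_B\Phi_X(b)\times\Phi_Y(b)\,dm^{(n)}(b)$; it is a regular $\boldsymbol{\sigma}$-system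 and the projections to $\mathcal{X}$ and $\mathcal{Y}$ are factors. *)

theory Defs
  imports "HOL-Probability.Probability" "HOL-Algebra.Group_Action"
begin

(* Index convention: families indexed in the mathematics by n >= -1 (the dimensions l_n and the
   columns nu^(n)) are indexed here by the level k = n + 1.  The matrices sigma^(n), the path
   coordinates X_n and the state spaces V_n start at n = 0 and keep their index, so sigma n has
   rows indexed by level n and columns indexed by level Suc n. *)

definition dim_at :: "(nat \<Rightarrow> nat) \<Rightarrow> nat \<Rightarrow> nat" where
  "dim_at l k = (case k of 0 \<Rightarrow> 1 | Suc n \<Rightarrow> l n)"

definition stochastic_sequence ::
  "('g, 'r) monoid_scheme \<Rightarrow> (nat \<Rightarrow> nat) \<Rightarrow> (nat \<Rightarrow> nat \<Rightarrow> nat \<Rightarrow> 'g measure) \<Rightarrow> bool" where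
  "stochastic_sequence G l \<sigma> \<longleftrightarrow>
     (\<forall>n. 0 < l n) \<and>
     (\<forall>n. \<forall>i<dim_at l n. \<forall>j<l n. sets (\<sigma> n i j) = sets (count_space (carrier G))) \<and>
     (\<forall>n. \<forall>i<dim_at l n. (\<Sum>j<l n. emeasure (\<sigma> n i j) (carrier G)) = 1)"

definition no_zero_columns ::
  "('g, 'r) monoid_scheme \<Rightarrow> (nat \<Rightarrow> nat) \<Rightarrow> (nat \<Rightarrow> nat \<Rightarrow> nat \<Rightarrow> 'g measure) \<Rightarrow> bool" where
  "no_zero_columns G l \<sigma> \<longleftrightarrow>
     (\<forall>n. \<forall>j<l n. \<exists>i<dim_at l n. 0 < emeasure (\<sigma> n i j) (carrier G))"

section \<open>Stationary systems\<close>

(* Only the space and the sigma-algebra of the field alg are used.  The measure fam X k j is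
   nu^(k-1)_j; in particular fam X 0 0 is nu^(-1), to which null sets refer. *)
record ('g, 'x) gsystem =
  alg :: "'x measure"
  act :: "'g \<Rightarrow> 'x \<Rightarrow> 'x"
  fam :: "nat \<Rightarrow> nat \<Rightarrow> 'x measure"

(* The restriction is there because the library's permutation group of a set consists of
   extensional functions. *)
definition measurable_action ::
  "('g, 'r) monoid_scheme \<Rightarrow> 'x measure \<Rightarrow> ('g \<Rightarrow> 'x \<Rightarrow> 'x) \<Rightarrow> bool" where
  "measurable_action G M \<alpha> \<longleftrightarrow>
     group_action G (space M) (\<lambda>g. restrict (\<alpha> g) (space M)) \<and>
     (\<forall>g\<in>carrier G. \<alpha> g \<in> measurable M M)"

abbreviation translate :: "('g, 'x) gsystem \<Rightarrow> 'g \<Rightarrow> 'x measure \<Rightarrow> 'x measure" where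
  "translate X g N \<equiv> distr N (alg X) (act X g)"

(* The value at A of the convolution of mu and N, that is of the sum of mu(g) gN over g in G. *)
definition conv_emeasure ::
  "('g, 'r) monoid_scheme \<Rightarrow> ('g, 'x) gsystem \<Rightarrow> 'g measure \<Rightarrow> 'x measure \<Rightarrow> 'x set \<Rightarrow> ennreal" where
  "conv_emeasure G X \<mu> N A =
     (\<integral>\<^sup>+ g. emeasure \<mu> {g} * emeasure (translate X g N) A \<partial>count_space (carrier G))"

definition sigma_system ::
  "('g, 'r) monoid_scheme \<Rightarrow> (nat \<Rightarrow> nat) \<Rightarrow> (nat \<Rightarrow> nat \<Rightarrow> nat \<Rightarrow> 'g measure) \<Rightarrow>
     ('g, 'x) gsystem \<Rightarrow> bool" where
  "sigma_system G l \<sigma> X \<longleftrightarrow>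
     measurable_action G (alg X) (act X) \<and>
     (\<forall>k. \<forall>j<dim_at l k. prob_space (fam X k j) \<and> sets (fam X k j) = sets (alg X)) \<and>
     (\<forall>n. \<forall>i<dim_at l n. \<forall>A\<in>sets (alg X).
        emeasure (fam X n i) A = (\<Sum>j<l n. conv_emeasure G X (\<sigma> n i j) (fam X (Suc n) j) A))"

definition standard_borel :: "'x measure \<Rightarrow> bool" where
  "standard_borel M \<longleftrightarrow>
     (\<exists>T. completely_metrizable_space T \<and> second_countable T \<and> topspace T = space M \<and>
          sets M = sigma_sets (space M) {U. openin T U})"

definition regular_system ::
  "('g, 'r) monoid_scheme \<Rightarrow> (nat \<Rightarrow> nat) \<Rightarrow> (nat \<Rightarrow> nat \<Rightarrow> nat \<Rightarrow> 'g measure) \<Rightarrow>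
     ('g, 'x) gsystem \<Rightarrow> bool" where
  "regular_system G l \<sigma> X \<longleftrightarrow> sigma_system G l \<sigma> X \<and> standard_borel (alg X)"

(* As usual in the measurable category, a G-map is equivariant up to null sets: for each g
   (equivalently, G being countable, for all g simultaneously) almost everywhere.  Strict
   equivariance could not be demanded of the conditional measures below: a fixed point of G
   in a null set of B would have to be sent to a G-invariant measure. *)
definition G_map ::
  "('g, 'r) monoid_scheme \<Rightarrow> 'x measure \<Rightarrow> 'x measure \<Rightarrow> ('g \<Rightarrow> 'x \<Rightarrow> 'x) \<Rightarrow>
     'y measure \<Rightarrow> ('g \<Rightarrow> 'y \<Rightarrow> 'y) \<Rightarrow> ('x \<Rightarrow> 'y) \<Rightarrow> bool" where
  "G_map G \<mu> M \<alpha> N \<beta> f \<longleftrightarrow>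
     f \<in> measurable M N \<and> (\<forall>g\<in>carrier G. AE x in \<mu>. f (\<alpha> g x) = \<beta> g (f x))"

definition factor_map ::
  "('g, 'r) monoid_scheme \<Rightarrow> (nat \<Rightarrow> nat) \<Rightarrow> ('g, 'x) gsystem \<Rightarrow> ('g, 'y) gsystem \<Rightarrow>
     ('x \<Rightarrow> 'y) \<Rightarrow> bool" where
  "factor_map G l X Y f \<longleftrightarrow>
     G_map G (fam X 0 0) (alg X) (act X) (alg Y) (act Y) f \<and>
     (\<forall>k. \<forall>j<dim_at l k. distr (fam X k j) (alg Y) f = fam Y k j)"

definition measure_preserving_extension ::
  "('g, 'r) monoid_scheme \<Rightarrow> (nat \<Rightarrow> nat) \<Rightarrow> (nat \<Rightarrow> nat \<Rightarrow> nat \<Rightarrow> 'g measure) \<Rightarrow>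
     ('g, 'x) gsystem \<Rightarrow> ('g, 'y) gsystem \<Rightarrow> ('x \<Rightarrow> 'y) \<Rightarrow> bool" where
  "measure_preserving_extension G l \<sigma> X Y f \<longleftrightarrow>
     sigma_system G l \<sigma> X \<and> sigma_system G l \<sigma> Y \<and> factor_map G l X Y f \<and>
     (\<forall>k. \<forall>i<dim_at l k. \<forall>g\<in>carrier G. AE x in fam X 0 0.
        RN_deriv (fam X 0 0) (translate X g (fam X k i)) x =
        RN_deriv (fam Y 0 0) (translate Y g (fam Y k i)) (f x))"

section \<open>The Poisson boundary\<close>

definition states :: "('g, 'r) monoid_scheme \<Rightarrow> (nat \<Rightarrow> nat) \<Rightarrow> nat \<Rightarrow> (nat \<times> 'g) set" where
  "states G l n = {..<l n} \<times> carrier G"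

definition paths :: "('g, 'r) monoid_scheme \<Rightarrow> (nat \<Rightarrow> nat) \<Rightarrow> (nat \<Rightarrow> nat \<times> 'g) set" where
  "paths G l = (\<Pi>\<^sub>E n\<in>UNIV. states G l n)"

definition path_act ::
  "('g, 'r) monoid_scheme \<Rightarrow> 'g \<Rightarrow> (nat \<Rightarrow> nat \<times> 'g) \<Rightarrow> (nat \<Rightarrow> nat \<times> 'g)" where
  "path_act G g \<omega> = (\<lambda>n. (fst (\<omega> n), g \<otimes>\<^bsub>G\<^esub> snd (\<omega> n)))"

definition coords_from ::
  "('g, 'r) monoid_scheme \<Rightarrow> (nat \<Rightarrow> nat) \<Rightarrow> nat \<Rightarrow> (nat \<Rightarrow> nat \<times> 'g) set set" where
  "coords_from G l m =
     sigma_sets (paths G l) {{\<omega> \<in> paths G l. \<omega> k \<in> S} | k S. m \<le> k \<and> S \<subseteq> states G l k}"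

definition tail_algebra ::
  "('g, 'r) monoid_scheme \<Rightarrow> (nat \<Rightarrow> nat) \<Rightarrow> (nat \<Rightarrow> nat \<times> 'g) measure" where
  "tail_algebra G l = sigma (paths G l) (\<Inter>m. coords_from G l m)"

(* Probability that the walk which is in state s at time n - 1 goes through the states xs at
   times n, n + 1, ... *)
fun path_prob ::
  "('g, 'r) monoid_scheme \<Rightarrow> (nat \<Rightarrow> nat \<Rightarrow> nat \<Rightarrow> 'g measure) \<Rightarrow> nat \<Rightarrow> nat \<times> 'g \<Rightarrow>
     (nat \<times> 'g) list \<Rightarrow> ennreal" where
  "path_prob G \<sigma> n s [] = 1"
| "path_prob G \<sigma> n s (x # xs) =
     emeasure (\<sigma> n (fst s) (fst x)) {inv\<^bsub>G\<^esub> (snd s) \<otimes>\<^bsub>G\<^esub> snd x} * path_prob G \<sigma> (Suc n) x xs"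

(* The law of the walk started at time k - 1 in state (i,e), as a measure on the sigma-algebra
   of the coordinates from time k - 1 on.  For k = 0 the starting state is not a coordinate, the
   first coordinate X_0 has distribution sigma^(0), and truncated subtraction yields the
   sigma-algebra of all coordinates; this is the Markov measure P. *)
definition walk_law ::
  "('g, 'r) monoid_scheme \<Rightarrow> (nat \<Rightarrow> nat) \<Rightarrow> (nat \<Rightarrow> nat \<Rightarrow> nat \<Rightarrow> 'g measure) \<Rightarrow>
     nat \<Rightarrow> nat \<Rightarrow> (nat \<Rightarrow> nat \<times> 'g) measure \<Rightarrow> bool" where
  "walk_law G l \<sigma> k i P \<longleftrightarrow>
     prob_space P \<and> space P = paths G l \<and> sets P = coords_from G l (k - 1) \<and>
     (\<forall>xs. (\<forall>r<length xs. xs ! r \<in> states G l (k + r)) \<longrightarrow>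
        emeasure P {\<omega> \<in> paths G l. (\<forall>m. k = Suc m \<longrightarrow> \<omega> m = (i, \<one>\<^bsub>G\<^esub>)) \<and>
                                   (\<forall>r<length xs. \<omega> (k + r) = xs ! r)} =
        path_prob G \<sigma> k (i, \<one>\<^bsub>G\<^esub>) xs)"

(* Representatives of the elements of L^infinity (real scalars). *)
definition Linf :: "'x measure \<Rightarrow> ('x \<Rightarrow> real) set" where
  "Linf M = {f \<in> borel_measurable M. \<exists>C. AE x in M. \<bar>f x\<bar> \<le> C}"

(* T acts on representatives and induces an algebra isomorphism between L^infinity(M) and
   L^infinity(N). *)
definition Linf_iso :: "'x measure \<Rightarrow> 'y measure \<Rightarrow> (('x \<Rightarrow> real) \<Rightarrow> ('y \<Rightarrow> real)) \<Rightarrow> bool" where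
  "Linf_iso M N T \<longleftrightarrow>
     (\<forall>f\<in>Linf M. T f \<in> Linf N) \<and>
     (\<forall>f\<in>Linf M. \<forall>f'\<in>Linf M. (AE x in M. f x = f' x) \<longleftrightarrow> (AE y in N. T f y = T f' y)) \<and>
     (\<forall>h\<in>Linf N. \<exists>f\<in>Linf M. AE y in N. T f y = h y) \<and>
     (\<forall>f\<in>Linf M. \<forall>f'\<in>Linf M. AE y in N. T (\<lambda>x. f x + f' x) y = T f y + T f' y) \<and>
     (\<forall>f\<in>Linf M. \<forall>c. AE y in N. T (\<lambda>x. c * f x) y = c * T f y) \<and>
     (\<forall>f\<in>Linf M. \<forall>f'\<in>Linf M. AE y in N. T (\<lambda>x. f x * f' x) y = T f y * T f' y) \<and>
     (AE y in N. T (\<lambda>_. 1) y = 1)"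

(* B is (a realization of) the Poisson boundary, which is only determined up to isomorphism.
   P k j is the walk law above, P 0 0 being the Markov measure on the path space. *)
definition poisson_boundary ::
  "('g, 'r) monoid_scheme \<Rightarrow> (nat \<Rightarrow> nat) \<Rightarrow> (nat \<Rightarrow> nat \<Rightarrow> nat \<Rightarrow> 'g measure) \<Rightarrow>
     ('g, 'b) gsystem \<Rightarrow> bool" where
  "poisson_boundary G l \<sigma> B \<longleftrightarrow>
     regular_system G l \<sigma> B \<and>
     (\<exists>P. (\<forall>k. \<forall>j<dim_at l k. walk_law G l \<sigma> k j (P k j)) \<and>
        (let N = restr_to_subalg (P 0 0) (tail_algebra G l) in
         \<exists>T. Linf_iso (fam B 0 0) N T \<and>
           (\<forall>f\<in>Linf (fam B 0 0). \<forall>g\<in>carrier G. AE \<omega> in N.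
              T (\<lambda>b. f (act B (inv\<^bsub>G\<^esub> g) b)) \<omega> = T f (path_act G (inv\<^bsub>G\<^esub> g) \<omega>)) \<and>
           (\<forall>f\<in>Linf (fam B 0 0). \<forall>k. \<forall>j<dim_at l k.
              (\<integral>b. f b \<partial>fam B k j) = (\<integral>\<omega>. T f \<omega> \<partial>P k j))))"

section \<open>Conditional measures, proximality and joinings\<close>

definition conditional_measures ::
  "('g, 'r) monoid_scheme \<Rightarrow> (nat \<Rightarrow> nat) \<Rightarrow> ('g, 'b) gsystem \<Rightarrow> ('g, 'x) gsystem \<Rightarrow>
     ('b \<Rightarrow> 'x measure) \<Rightarrow> bool" where
  "conditional_measures G l B X \<Phi> \<longleftrightarrow>
     G_map G (fam B 0 0) (alg B) (act B) (prob_algebra (alg X)) (translate X) \<Phi> \<and>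
     (\<forall>k. \<forall>j<dim_at l k. \<forall>g\<in>carrier G.
        translate X g (fam X k j) = Giry_Monad.bind (translate B g (fam B k j)) \<Phi>)"

definition Pi_system ::
  "('g, 'b) gsystem \<Rightarrow> ('g, 'x) gsystem \<Rightarrow> ('b \<Rightarrow> 'x measure) \<Rightarrow> ('g, 'x measure) gsystem" where
  "Pi_system B X \<Phi> =
     \<lparr>alg = prob_algebra (alg X), act = translate X,
      fam = (\<lambda>k j. distr (fam B k j) (prob_algebra (alg X)) \<Phi>)\<rparr>"

definition iso_mod_null :: "'x measure \<Rightarrow> 'y measure \<Rightarrow> ('x \<Rightarrow> 'y) \<Rightarrow> bool" where
  "iso_mod_null M N f \<longleftrightarrow>
     f \<in> measurable M N \<and> distr M N f = N \<and>
     (\<exists>A\<in>sets M. \<exists>C\<in>sets N. space M - A \<in> null_sets M \<and> space N - C \<in> null_sets N \<and>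
        bij_betw f A C \<and>
        f \<in> measurable (restrict_space M A) (restrict_space N C) \<and>
        the_inv_into A f \<in> measurable (restrict_space N C) (restrict_space M A))"

(* The conditional measures exist and are unique up to a.e. equality, so the last three
   conjuncts say that Phi_X(b) and Phi_Y(b) are identified by f for a.e. b. *)
definition proximal_extension ::
  "('g, 'r) monoid_scheme \<Rightarrow> (nat \<Rightarrow> nat) \<Rightarrow> (nat \<Rightarrow> nat \<Rightarrow> nat \<Rightarrow> 'g measure) \<Rightarrow>
     ('g, 'b) gsystem \<Rightarrow> ('g, 'x) gsystem \<Rightarrow> ('g, 'y) gsystem \<Rightarrow> ('x \<Rightarrow> 'y) \<Rightarrow> bool" where
  "proximal_extension G l \<sigma> B X Y f \<longleftrightarrow>
     regular_system G l \<sigma> X \<and> regular_system G l \<sigma> Y \<and> factor_map G l X Y f \<and>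
     (\<exists>\<Phi>. conditional_measures G l B X \<Phi>) \<and> (\<exists>\<Psi>. conditional_measures G l B Y \<Psi>) \<and>
     (\<forall>\<Phi> \<Psi>. conditional_measures G l B X \<Phi> \<longrightarrow> conditional_measures G l B Y \<Psi> \<longrightarrow>
        (AE b in fam B 0 0. iso_mod_null (\<Phi> b) (\<Psi> b) f))"

definition point_system :: "('g, unit) gsystem" where
  "point_system =
     \<lparr>alg = count_space UNIV, act = (\<lambda>_ x. x), fam = (\<lambda>_ _. return (count_space UNIV) ())\<rparr>"

definition proximal_system ::
  "('g, 'r) monoid_scheme \<Rightarrow> (nat \<Rightarrow> nat) \<Rightarrow> (nat \<Rightarrow> nat \<Rightarrow> nat \<Rightarrow> 'g measure) \<Rightarrow>
     ('g, 'b) gsystem \<Rightarrow> ('g, 'x) gsystem \<Rightarrow> bool" where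
  "proximal_system G l \<sigma> B X \<longleftrightarrow> proximal_extension G l \<sigma> B X point_system (\<lambda>_. ())"

definition joining ::
  "('g, 'b) gsystem \<Rightarrow> ('g, 'x) gsystem \<Rightarrow> ('b \<Rightarrow> 'x measure) \<Rightarrow>
     ('g, 'y) gsystem \<Rightarrow> ('b \<Rightarrow> 'y measure) \<Rightarrow> ('g, 'x \<times> 'y) gsystem" where
  "joining B X \<Phi> Y \<Psi> =
     \<lparr>alg = alg X \<Otimes>\<^sub>M alg Y,
      act = (\<lambda>g. map_prod (act X g) (act Y g)),
      fam = (\<lambda>k j. Giry_Monad.bind (fam B k j) (\<lambda>b. \<Phi> b \<Otimes>\<^sub>M \<Psi> b))\<rparr>"

end

theory Submission
  imports Defs
begin

text \<open>
Write \<open>\<Lambda>\<close> for the proximal system and \<open>m\<close> for the measures on the Poisson boundary \<open>B\<close>. Everything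
rests on one rigidity property of the boundary (\<open>boundary_function_zero\<close>): a bounded measurable
function on \<open>B\<close> whose integral against every translate of every measure \<open>m\<^bsub>n,j\<^esub>\<close> vanishes is zero almost everywhere.
Indeed, such a function corresponds to a tail function \<open>F\<close> on path space, and by the Markov property
and equivariance the integral of \<open>F\<close> over a cylinder ending in \<open>(j, g)\<close> at time \<open>n\<close> is the probability of
the cylinder times the integral of the given function against \<open>g m\<^bsub>n,j\<^esub>\<close>. So \<open>F\<close> integrates to zero over
all cylinders, and these form a generating family stable under intersections. In a standard Borel
space measures are determined by countably many sets, so a measurable family of probability measures
over \<open>B\<close> is determined almost everywhere by its barycenters with respect to all the measures
\<open>g m\<^bsub>n,j\<^esub>\<close> (\<open>kernel_unique\<close>).

The kernel \<open>b \<mapsto> \<Phi> b \<times> \<Psi> b\<close> is equivariant, which makes the joining a \<open>\<sigma>\<close>-system with these conditional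
measures. As \<open>\<Lambda>\<close> is proximal, almost every \<open>\<Psi> b\<close> is a point mass at some \<open>y\<close>, and the first projection
from \<open>\<Phi> b \<times> \<delta>\<^sub>y\<close> to \<open>\<Phi> b\<close> is an isomorphism modulo null sets. By uniqueness of conditional measures
this is the proximality of the first projection.

For the second projection, let \<open>\<pi>\<close> be the factor map from \<open>\<Lambda>\<close> to the system of conditional measures of
\<open>X\<close>. The families \<open>\<Phi>\<close> and \<open>b \<mapsto> \<integral> \<pi> d\<Psi>\<^sub>b\<close> have the same barycenters, hence agree almost everywhere
(\<open>conditional_measures_via_factor\<close>), that is, for almost every \<open>b\<close>, if \<open>\<Psi> b\<close> is the point mass at \<open>y\<close>,
then \<open>\<Phi> b = \<pi> y\<close>. So
all measures of the joining and their translates are obtained from the corresponding measures of \<open>\<Lambda>\<close>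
by integrating one and the same kernel \<open>y \<mapsto> \<pi> y \<times> \<delta>\<^sub>y\<close>, which lives over \<open>y\<close>. Passing through this kernel
turns a density on \<open>\<Lambda>\<close> into its composition with the second projection, which is the claim.

The hypotheses on the support of \<open>\<sigma>\<close> make all translates of all measures of a \<open>\<sigma>\<close>-system absolutely
continuous with respect to the first one (\<open>translate_null\<close>), so that statements that hold almost
everywhere for the latter can be integrated against the former.
\<close>

section \<open>Measurable actions and stationary systems\<close>

lemma measurable_actionD:
  assumes "measurable_action G M \<alpha>"
  shows "g \<in> carrier G \<Longrightarrow> \<alpha> g \<in> measurable M M"
    and "x \<in> space M \<Longrightarrow> \<alpha> \<one>\<^bsub>G\<^esub> x = x"
    and "g \<in> carrier G \<Longrightarrow> h \<in> carrier G \<Longrightarrow> x \<in> space M \<Longrightarrow> \<alpha> (g \<otimes>\<^bsub>G\<^esub> h) x = \<alpha> g (\<alpha> h x)"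
    and "g \<in> carrier G \<Longrightarrow> x \<in> space M \<Longrightarrow> \<alpha> (inv\<^bsub>G\<^esub> g) (\<alpha> g x) = x"
    and "g \<in> carrier G \<Longrightarrow> x \<in> space M \<Longrightarrow> \<alpha> g (\<alpha> (inv\<^bsub>G\<^esub> g) x) = x"
proof -
  interpret A: group_action G "space M" "\<lambda>g. restrict (\<alpha> g) (space M)"
    using assms by (simp add: measurable_action_def)
  interpret group G using A.group_hom by (simp add: group_hom_def)
  show meas: "\<alpha> g \<in> measurable M M" if "g \<in> carrier G" for g
    using that assms by (simp add: measurable_action_def)
  show one: "\<alpha> \<one>\<^bsub>G\<^esub> x = x" if "x \<in> space M" for x
    using that fun_cong[OF A.id_eq_one, of x] by simp
  show mult: "\<alpha> (g \<otimes>\<^bsub>G\<^esub> h) x = \<alpha> g (\<alpha> h x)"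
    if "g \<in> carrier G" "h \<in> carrier G" "x \<in> space M" for g h x
    using that A.composition_rule[of x g h] measurable_space[OF meas[of h]] by simp
  show "\<alpha> (inv\<^bsub>G\<^esub> g) (\<alpha> g x) = x" if "g \<in> carrier G" "x \<in> space M"
    using that mult[of "inv\<^bsub>G\<^esub> g" g x] one by simp
  show "\<alpha> g (\<alpha> (inv\<^bsub>G\<^esub> g) x) = x" if "g \<in> carrier G" "x \<in> space M"
    using that mult[of g "inv\<^bsub>G\<^esub> g" x] one by simp
qed

lemma (in group) measurable_actionI:
  assumes meas: "\<And>g. g \<in> carrier G \<Longrightarrow> \<alpha> g \<in> measurable M M"
    and one: "\<And>x. x \<in> space M \<Longrightarrow> \<alpha> \<one> x = x"
    and mult: "\<And>g h x. g \<in> carrier G \<Longrightarrow> h \<in> carrier G \<Longrightarrow> x \<in> space M \<Longrightarrow> \<alpha> (g \<otimes> h) x = \<alpha> g (\<alpha> h x)"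
  shows "measurable_action G M \<alpha>"
proof -
  let ?\<phi> = "\<lambda>g. restrict (\<alpha> g) (space M)"
  have closed: "\<alpha> g x \<in> space M" if "g \<in> carrier G" "x \<in> space M" for g x
    using measurable_space[OF meas] that by blast
  have Bij: "?\<phi> g \<in> Bij (space M)" if g: "g \<in> carrier G" for g
  proof -
    have "\<alpha> (inv g) (\<alpha> g x) = x" "\<alpha> g (\<alpha> (inv g) x) = x" if "x \<in> space M" for x
      using that g mult[of g "inv g" x] mult[of "inv g" g x] one by auto
    then have "bij_betw (?\<phi> g) (space M) (space M)"
      using g closed by (intro bij_betwI[where g = "\<alpha> (inv g)"]) auto
    then show ?thesis by (simp add: Bij_def)
  qed
  have "group_hom G (BijGroup (space M)) ?\<phi>"
  proof (intro group_hom.intro group_hom_axioms.intro homI)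
    show "?\<phi> g \<in> carrier (BijGroup (space M))" if "g \<in> carrier G" for g
      using Bij[OF that] by (simp add: BijGroup_def)
    show "?\<phi> (g \<otimes> h) = ?\<phi> g \<otimes>\<^bsub>BijGroup (space M)\<^esub> ?\<phi> h" if "g \<in> carrier G" "h \<in> carrier G" for g h
      using that Bij mult closed by (auto simp: BijGroup_def compose_def fun_eq_iff restrict_def)
  qed (rule is_group group_BijGroup)+
  then show ?thesis
    using meas by (simp add: measurable_action_def group_action_def)
qed

lemma sigma_systemD:
  assumes "sigma_system G l \<sigma> X"
  shows "measurable_action G (alg X) (act X)"
    and "j < dim_at l k \<Longrightarrow> prob_space (fam X k j)"
    and "j < dim_at l k \<Longrightarrow> sets (fam X k j) = sets (alg X)"
    and "j < dim_at l k \<Longrightarrow> space (fam X k j) = space (alg X)"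
    and "j < dim_at l k \<Longrightarrow> fam X k j \<in> space (prob_algebra (alg X))"
  using assms by (auto simp: sigma_system_def space_prob_algebra intro!: sets_eq_imp_space_eq)

text \<open>Stationarity, which is stated for sets, extends to nonnegative functions.\<close>

lemma sigma_system_nn_integral:
  assumes X: "sigma_system G l \<sigma> X" and i: "i < dim_at l n"
    and f: "f \<in> borel_measurable (alg X)"
  shows "(\<integral>\<^sup>+x. f x \<partial>fam X n i) = (\<Sum>j<l n. \<integral>\<^sup>+g. emeasure (\<sigma> n i j) {g} *
      (\<integral>\<^sup>+x. f (act X g x) \<partial>fam X (Suc n) j) \<partial>count_space (carrier G))"
  using f
proof (induction f rule: borel_measurable_induct)
  case (cong f g)
  have "(\<integral>\<^sup>+x. f x \<partial>fam X n i) = (\<integral>\<^sup>+x. g x \<partial>fam X n i)"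
    using cong sigma_systemD(4)[OF X i] by (intro nn_integral_cong) auto
  moreover have "(\<integral>\<^sup>+x. f (act X h x) \<partial>fam X (Suc n) j) = (\<integral>\<^sup>+x. g (act X h x) \<partial>fam X (Suc n) j)"
    if "j < l n" "h \<in> carrier G" for j h
    using that cong sigma_systemD(4)[OF X, of j "Suc n"]
      measurable_space[OF measurable_actionD(1)[OF sigma_systemD(1)[OF X]]]
    by (intro nn_integral_cong) (auto simp: dim_at_def)
  ultimately show ?case using cong by (auto intro!: sum.cong nn_integral_cong)
next
  case (set A)
  have [measurable]: "act X h \<in> measurable (alg X) (alg X)" if "h \<in> carrier G" for h
    using measurable_actionD(1)[OF sigma_systemD(1)[OF X] that] .
  have "emeasure (translate X h (fam X (Suc n) j)) A = (\<integral>\<^sup>+x. indicator A (act X h x) \<partial>fam X (Suc n) j)"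
    if "j < l n" "h \<in> carrier G" for j h
  proof -
    have m: "act X h \<in> measurable (fam X (Suc n) j) (alg X)"
      using that sigma_systemD(3)[OF X, of j "Suc n"] by (simp add: dim_at_def cong: measurable_cong_sets)
    show ?thesis
      using set nn_integral_distr[OF m, of "indicator A"] by (simp add: nn_integral_indicator)
  qed
  then show ?case
    using X i set sigma_systemD(3)[OF X i]
    by (auto simp: sigma_system_def conv_emeasure_def intro!: sum.cong nn_integral_cong)
next
  case (mult u c)
  have m: "(\<lambda>x. u (act X h x)) \<in> borel_measurable (fam X (Suc n) j)" if "j < l n" "h \<in> carrier G" for j h
    using that sigma_systemD(3)[OF X, of j "Suc n"] mult(2)
      measurable_compose[OF measurable_actionD(1)[OF sigma_systemD(1)[OF X] that(2)]]
    by (simp add: dim_at_def cong: measurable_cong_sets)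
  have u: "u \<in> borel_measurable (fam X n i)"
    using mult sigma_systemD(3)[OF X i] by (simp cong: measurable_cong_sets)
  have "(\<Sum>j<l n. \<integral>\<^sup>+g. emeasure (\<sigma> n i j) {g} *
      (\<integral>\<^sup>+x. c * u (act X g x) \<partial>fam X (Suc n) j) \<partial>count_space (carrier G)) =
    (\<Sum>j<l n. \<integral>\<^sup>+g. c * (emeasure (\<sigma> n i j) {g} *
      (\<integral>\<^sup>+x. u (act X g x) \<partial>fam X (Suc n) j)) \<partial>count_space (carrier G))"
    using m by (intro sum.cong nn_integral_cong) (auto simp: nn_integral_cmult ac_simps)
  also have "\<dots> = c * (\<integral>\<^sup>+x. u x \<partial>fam X n i)"
    unfolding mult.IH sum_distrib_left by (intro sum.cong refl nn_integral_cmult) simp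
  also have "\<dots> = (\<integral>\<^sup>+x. c * u x \<partial>fam X n i)"
    using u by (intro nn_integral_cmult[symmetric])
  finally show ?case by (rule sym)
next
  case (add u v)
  have m: "(\<lambda>x. w (act X h x)) \<in> borel_measurable (fam X (Suc n) j)"
    if "j < l n" "h \<in> carrier G" "w \<in> borel_measurable (alg X)" for j h and w :: "_ \<Rightarrow> ennreal"
    using that sigma_systemD(3)[OF X, of j "Suc n"]
      measurable_compose[OF measurable_actionD(1)[OF sigma_systemD(1)[OF X] that(2)] that(3)]
    by (simp add: dim_at_def cong: measurable_cong_sets)
  have u: "w \<in> borel_measurable (fam X n i)" if "w \<in> borel_measurable (alg X)" for w :: "_ \<Rightarrow> ennreal"
    using that sigma_systemD(3)[OF X i] by (simp cong: measurable_cong_sets)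
  have "(\<Sum>j<l n. \<integral>\<^sup>+g. emeasure (\<sigma> n i j) {g} *
      (\<integral>\<^sup>+x. v (act X g x) + u (act X g x) \<partial>fam X (Suc n) j) \<partial>count_space (carrier G)) =
    (\<Sum>j<l n. \<integral>\<^sup>+g. emeasure (\<sigma> n i j) {g} * (\<integral>\<^sup>+x. v (act X g x) \<partial>fam X (Suc n) j) +
       emeasure (\<sigma> n i j) {g} * (\<integral>\<^sup>+x. u (act X g x) \<partial>fam X (Suc n) j) \<partial>count_space (carrier G))"
    using m[OF _ _ add(1)] m[OF _ _ add(3)]
    by (intro sum.cong nn_integral_cong) (simp_all add: nn_integral_add distrib_left)
  also have "\<dots> = (\<integral>\<^sup>+x. v x \<partial>fam X n i) + (\<integral>\<^sup>+x. u x \<partial>fam X n i)"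
    unfolding add.IH sum.distrib[symmetric] by (intro sum.cong refl nn_integral_add) simp_all
  also have "\<dots> = (\<integral>\<^sup>+x. v x + u x \<partial>fam X n i)"
    using u[OF add(1)] u[OF add(3)] by (intro nn_integral_add[symmetric])
  finally show ?case by (rule sym)
next
  case (seq U)
  have inc: "incseq U" by (rule seq)
  have m: "(\<lambda>x. U r (act X h x)) \<in> borel_measurable (fam X (Suc n) j)"
    if "j < l n" "h \<in> carrier G" for j h r
    using that sigma_systemD(3)[OF X, of j "Suc n"]
      measurable_compose[OF measurable_actionD(1)[OF sigma_systemD(1)[OF X] that(2)] seq(1)[of r]]
    by (simp add: dim_at_def cong: measurable_cong_sets)
  have u: "U r \<in> borel_measurable (fam X n i)" for r
    using seq sigma_systemD(3)[OF X i] by (simp cong: measurable_cong_sets)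
  let ?I = "\<lambda>r j g. \<integral>\<^sup>+x. U r (act X g x) \<partial>fam X (Suc n) j"
  have incI: "incseq (\<lambda>r. ?I r j g)" for j g
    using inc by (auto simp: incseq_def le_fun_def intro!: nn_integral_mono)
  have incJ: "incseq (\<lambda>r. \<integral>\<^sup>+g. emeasure (\<sigma> n i j) {g} * ?I r j g \<partial>count_space (carrier G))" for j
    by (intro incseq_SucI nn_integral_mono mult_left_mono incseq_SucD[OF incI] zero_le)
  have "(\<integral>\<^sup>+g. emeasure (\<sigma> n i j) {g} * (\<integral>\<^sup>+x. (SUP r. U r) (act X g x) \<partial>fam X (Suc n) j) \<partial>count_space (carrier G)) =
    (SUP r. \<integral>\<^sup>+g. emeasure (\<sigma> n i j) {g} * ?I r j g \<partial>count_space (carrier G))" if j: "j < l n" for j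
  proof -
    have "emeasure (\<sigma> n i j) {g} * (\<integral>\<^sup>+x. (SUP r. U r) (act X g x) \<partial>fam X (Suc n) j) =
        (SUP r. emeasure (\<sigma> n i j) {g} * ?I r j g)" if "g \<in> carrier G" for g
    proof -
      have "incseq (\<lambda>r x. U r (act X g x))" using inc by (auto simp: incseq_def le_fun_def)
      then have "(\<integral>\<^sup>+x. (SUP r. U r) (act X g x) \<partial>fam X (Suc n) j) = (SUP r. ?I r j g)"
        using nn_integral_monotone_convergence_SUP[of "\<lambda>r x. U r (act X g x)" "fam X (Suc n) j"] m[OF j that]
        by (simp add: image_comp)
      then show ?thesis by (simp add: SUP_mult_left_ennreal)
    qed
    then have "(\<integral>\<^sup>+g. emeasure (\<sigma> n i j) {g} * (\<integral>\<^sup>+x. (SUP r. U r) (act X g x) \<partial>fam X (Suc n) j) \<partial>count_space (carrier G)) =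
       (\<integral>\<^sup>+g. (SUP r. emeasure (\<sigma> n i j) {g} * ?I r j g) \<partial>count_space (carrier G))"
      by (intro nn_integral_cong) simp
    also have "\<dots> = (SUP r. \<integral>\<^sup>+g. emeasure (\<sigma> n i j) {g} * ?I r j g \<partial>count_space (carrier G))"
      by (intro nn_integral_monotone_convergence_SUP incseq_SucI le_funI mult_left_mono
            incseq_SucD[OF incI] zero_le) simp
    finally show ?thesis .
  qed
  then have "(\<Sum>j<l n. \<integral>\<^sup>+g. emeasure (\<sigma> n i j) {g} * (\<integral>\<^sup>+x. (SUP r. U r) (act X g x) \<partial>fam X (Suc n) j) \<partial>count_space (carrier G))
      = (\<Sum>j<l n. SUP r. \<integral>\<^sup>+g. emeasure (\<sigma> n i j) {g} * ?I r j g \<partial>count_space (carrier G))"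
    by simp
  also have "\<dots> = (SUP r. \<Sum>j<l n. \<integral>\<^sup>+g. emeasure (\<sigma> n i j) {g} * ?I r j g \<partial>count_space (carrier G))"
    using incJ by (intro ennreal_SUP_sum[symmetric]) auto
  also have "\<dots> = (SUP r. \<integral>\<^sup>+x. U r x \<partial>fam X n i)"
    using seq by simp
  also have "\<dots> = (\<integral>\<^sup>+x. (SUP r. U r) x \<partial>fam X n i)"
    using nn_integral_monotone_convergence_SUP[OF inc, of "fam X n i"] u by (simp add: image_comp)
  finally show ?case by simp
qed

section \<open>Cylinder sets and translation of paths\<close>

text \<open>The paths that pass through the states of the list at times \<open>m, m + 1, \<dots>\<close>\<close>

definition cylinder ::
  "('g, 'r) monoid_scheme \<Rightarrow> (nat \<Rightarrow> nat) \<Rightarrow> nat \<Rightarrow> (nat \<times> 'g) list \<Rightarrow> (nat \<Rightarrow> nat \<times> 'g) set" where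
  "cylinder G l m xs = {\<omega> \<in> paths G l. \<forall>r<length xs. \<omega> (m + r) = xs ! r}"

text \<open>Lists of admissible states for the times \<open>m, m + 1, \<dots>\<close>\<close>

definition itinerary :: "('g, 'r) monoid_scheme \<Rightarrow> (nat \<Rightarrow> nat) \<Rightarrow> nat \<Rightarrow> (nat \<times> 'g) list \<Rightarrow> bool" where
  "itinerary G l m xs \<longleftrightarrow> (\<forall>r<length xs. xs ! r \<in> states G l (m + r))"

text \<open>The empty set is included so that this family is stable under intersections.\<close>

definition cylinders ::
  "('g, 'r) monoid_scheme \<Rightarrow> (nat \<Rightarrow> nat) \<Rightarrow> nat \<Rightarrow> (nat \<Rightarrow> nat \<times> 'g) set set" where
  "cylinders G l m = insert {} (cylinder G l m ` {xs. itinerary G l m xs})"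

lemma cylinder_subset: "cylinder G l m xs \<subseteq> paths G l"
  by (auto simp: cylinder_def)

lemma cylinder_Nil [simp]: "cylinder G l m [] = paths G l"
  by (auto simp: cylinder_def)

lemma itinerary_Nil [simp]: "itinerary G l m []"
  by (auto simp: itinerary_def)

lemma itinerary_Cons [simp]:
  "itinerary G l m (x # xs) \<longleftrightarrow> x \<in> states G l m \<and> itinerary G l (Suc m) xs"
  by (auto simp: itinerary_def nth_Cons split: nat.splits)

lemma itinerary_append:
  "itinerary G l m (xs @ ys) \<longleftrightarrow> itinerary G l m xs \<and> itinerary G l (m + length xs) ys"
  by (induction xs arbitrary: m) auto

lemma cylinder_Cons:
  "cylinder G l m (x # xs) = {\<omega> \<in> paths G l. \<omega> m = x} \<inter> cylinder G l (Suc m) xs"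
  by (auto simp: cylinder_def nth_Cons split: nat.splits)

lemma cylinder_append:
  "cylinder G l m (xs @ ys) = cylinder G l m xs \<inter> cylinder G l (m + length xs) ys"
proof (induction xs arbitrary: m)
  case Nil
  then show ?case using cylinder_subset[of G l m ys] by auto
qed (auto simp: cylinder_Cons)

lemma cylinders_subset: "cylinders G l m \<subseteq> Pow (paths G l)"
  using cylinder_subset by (fastforce simp: cylinders_def)

lemma paths_in_cylinders: "paths G l \<in> cylinders G l m"
  unfolding cylinders_def by (metis (mono_tags) cylinder_Nil image_eqI insertCI itinerary_Nil mem_Collect_eq)

lemma Int_stable_cylinders: "Int_stable (cylinders G l m)"
proof -
  have short: "cylinder G l m xs \<inter> cylinder G l m ys \<in> cylinders G l m"
    if "itinerary G l m ys" "length xs \<le> length ys" for xs ys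
  proof (cases "\<forall>r<length xs. xs ! r = ys ! r")
    case True
    then have "cylinder G l m xs \<inter> cylinder G l m ys = cylinder G l m ys"
      using that by (fastforce simp: cylinder_def)
    then show ?thesis using that by (auto simp: cylinders_def)
  next
    case False
    then have "cylinder G l m xs \<inter> cylinder G l m ys = {}"
      using that by (fastforce simp: cylinder_def)
    then show ?thesis by (auto simp: cylinders_def)
  qed
  have "cylinder G l m xs \<inter> cylinder G l m ys \<in> cylinders G l m"
    if "itinerary G l m xs" "itinerary G l m ys" for xs ys
    using short[of ys xs] short[of xs ys] that by (metis Int_commute nle_le)
  then show ?thesis
    unfolding Int_stable_def by (auto simp: cylinders_def)
qed

text \<open>As there are only countably many itineraries, a condition on a single coordinate is a countable
  union of cylinders.\<close>

lemma coords_from_eq_cylinders: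
  assumes "countable (carrier G)"
  shows "coords_from G l m = sigma_sets (paths G l) (cylinders G l m)"
proof -
  define S where "S = sigma_sets (paths G l) {{\<omega> \<in> paths G l. \<omega> k \<in> S} | k S. m \<le> k \<and> S \<subseteq> states G l k}"
  interpret S: sigma_algebra "paths G l" S
    unfolding S_def by (rule sigma_algebra_sigma_sets) auto
  interpret C: sigma_algebra "paths G l" "sigma_sets (paths G l) (cylinders G l m)"
    by (rule sigma_algebra_sigma_sets) (rule cylinders_subset)
  have point: "{\<omega> \<in> paths G l. \<omega> k \<in> A} \<in> S" if "m \<le> k" "A \<subseteq> states G l k" for k A
    unfolding S_def using that by (intro sigma_sets.Basic) auto
  have cyl: "cylinder G l n xs \<in> S" if "itinerary G l n xs" "m \<le> n" for n xs
    using that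
  proof (induction xs arbitrary: n)
    case Nil
    then show ?case using S.top by simp
  next
    case (Cons x xs)
    have "cylinder G l n (x # xs) = {\<omega> \<in> paths G l. \<omega> n \<in> {x}} \<inter> cylinder G l (Suc n) xs"
      by (auto simp: cylinder_Cons)
    also have "\<dots> \<in> S"
      using Cons by (intro S.Int point Cons.IH) auto
    finally show ?case .
  qed
  have "cylinders G l m \<subseteq> S"
    using cyl by (auto simp: cylinders_def)
  moreover have "{\<omega> \<in> paths G l. \<omega> k \<in> A} \<in> sigma_sets (paths G l) (cylinders G l m)"
    if "m \<le> k" "A \<subseteq> states G l k" for k A
  proof -
    \<comment> \<open>Itineraries from time \<open>m\<close> up to time \<open>k\<close> whose last state lies in \<open>A\<close>\<close>
    define I where "I = {xs. itinerary G l m xs \<and> length xs = Suc (k - m) \<and> xs ! (k - m) \<in> A}"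
    have "I \<subseteq> lists (UNIV \<times> carrier G)"
      by (fastforce simp: I_def itinerary_def states_def in_set_conv_nth mem_Times_iff)
    moreover have "countable (lists ((UNIV :: nat set) \<times> carrier G))"
      using assms by (intro countable_lists countable_SIGMA) auto
    ultimately have "countable I" by (rule countable_subset)
    have "\<exists>xs\<in>I. \<omega> \<in> cylinder G l m xs" if "\<omega> \<in> paths G l" "\<omega> k \<in> A" for \<omega>
    proof (rule bexI)
      let ?xs = "map (\<lambda>r. \<omega> (m + r)) [0..<Suc (k - m)]"
      have nth: "?xs ! r = \<omega> (m + r)" if "r < length ?xs" for r
        using that by (simp del: upt_Suc)
      show "\<omega> \<in> cylinder G l m ?xs"
        using that nth by (auto simp: cylinder_def simp del: upt_Suc)
      show "?xs \<in> I"
        using that nth \<open>m \<le> k\<close> by (auto simp: I_def itinerary_def paths_def PiE_iff simp del: upt_Suc)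
    qed
    moreover have "\<omega> k \<in> A" if "xs \<in> I" "\<omega> \<in> cylinder G l m xs" for xs \<omega>
    proof -
      have "\<omega> (m + (k - m)) = xs ! (k - m)" using that by (auto simp: I_def cylinder_def)
      then show ?thesis using that \<open>m \<le> k\<close> by (auto simp: I_def)
    qed
    ultimately have "{\<omega> \<in> paths G l. \<omega> k \<in> A} = (\<Union>xs\<in>I. cylinder G l m xs)"
      using cylinder_subset by fast
    also have "\<dots> \<in> sigma_sets (paths G l) (cylinders G l m)"
      using \<open>countable I\<close>
      by (intro C.countable_UN'') (auto simp: I_def cylinders_def)
    finally show ?thesis .
  qed
  ultimately show ?thesis
    unfolding coords_from_def S_def[symmetric]
    by (intro antisym S.sigma_sets_subset)
       (auto simp: S_def intro!: C.sigma_sets_subset)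
qed

lemma path_prob_append:
  assumes "xs \<noteq> []"
  shows "path_prob G \<sigma> n s (xs @ ys) = path_prob G \<sigma> n s xs * path_prob G \<sigma> (n + length xs) (last xs) ys"
  using assms
proof (induction xs arbitrary: n s)
  case (Cons x xs)
  then show ?case by (cases "xs = []") (auto simp: mult.assoc)
qed simp

text \<open>The action of the group on a state: left translation of the second coordinate.\<close>

abbreviation lshift :: "('g, 'r) monoid_scheme \<Rightarrow> 'g \<Rightarrow> nat \<times> 'g \<Rightarrow> nat \<times> 'g" where
  "lshift G g \<equiv> apsnd (\<lambda>h. g \<otimes>\<^bsub>G\<^esub> h)"

context group begin

lemma path_prob_lshift:
  assumes "g \<in> carrier G" "snd s \<in> carrier G" "itinerary G l m xs"
  shows "path_prob G \<sigma> n (lshift G g s) (map (lshift G g) xs) = path_prob G \<sigma> n s xs"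
  using assms
proof (induction xs arbitrary: n s m)
  case (Cons x xs)
  have x: "snd x \<in> carrier G" using Cons.prems by (auto simp: states_def)
  have "inv (g \<otimes> snd s) \<otimes> (g \<otimes> snd x) = inv (snd s) \<otimes> snd x"
    using Cons.prems x by (simp add: inv_mult_group m_assoc) (simp add: m_assoc[symmetric])
  moreover have "path_prob G \<sigma> (Suc n) (lshift G g x) (map (lshift G g) xs) = path_prob G \<sigma> (Suc n) x xs"
    using Cons.prems x by (intro Cons.IH[of _ "Suc m"]) auto
  ultimately show ?case by simp
qed simp

lemma path_act_in_paths:
  assumes "g \<in> carrier G" "\<omega> \<in> paths G l"
  shows "path_act G g \<omega> \<in> paths G l"
  using assms by (auto simp: paths_def path_act_def states_def PiE_iff mem_Times_iff)

lemma path_act_inverse: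
  assumes "g \<in> carrier G" "\<omega> \<in> paths G l"
  shows "path_act G (inv g) (path_act G g \<omega>) = \<omega>"
proof
  fix n
  have "snd (\<omega> n) \<in> carrier G" using assms by (auto simp: paths_def states_def PiE_iff mem_Times_iff)
  then show "path_act G (inv g) (path_act G g \<omega>) n = \<omega> n"
    using assms by (auto simp: path_act_def m_assoc[symmetric] prod_eq_iff)
qed

lemma itinerary_lshift:
  assumes "g \<in> carrier G" "itinerary G l m xs"
  shows "itinerary G l m (map (lshift G g) xs)"
  using assms by (auto simp: itinerary_def states_def mem_Times_iff)

lemma path_act_vimage_cylinder:
  assumes "g \<in> carrier G" "itinerary G l m xs"
  shows "path_act G g -` cylinder G l m xs \<inter> paths G l = cylinder G l m (map (lshift G (inv g)) xs)"
proof (rule Set.set_eqI)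
  fix \<omega>
  have "path_act G g \<omega> (m + r) = xs ! r \<longleftrightarrow> \<omega> (m + r) = map (lshift G (inv g)) xs ! r"
    if "r < length xs" "\<omega> \<in> paths G l" for r
  proof -
    have "snd (\<omega> (m + r)) \<in> carrier G" "snd (xs ! r) \<in> carrier G"
      using assms that by (auto simp: paths_def states_def PiE_iff mem_Times_iff itinerary_def)
    then show ?thesis
      using assms that by (auto simp: path_act_def prod_eq_iff inv_solve_left)
  qed
  then show "\<omega> \<in> path_act G g -` cylinder G l m xs \<inter> paths G l \<longleftrightarrow>
      \<omega> \<in> cylinder G l m (map (lshift G (inv g)) xs)"
    using path_act_in_paths[OF assms(1)] by (auto simp: cylinder_def)
qed


end

section \<open>The Markov property of the walk\<close>

lemma sigma_sets_subset_Pow: "A \<subseteq> Pow S \<Longrightarrow> sigma_sets S A \<subseteq> Pow S"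
  using sigma_sets_into_sp by blast

lemma walk_law_0_cylinder:
  assumes "walk_law G l \<sigma> 0 i P" "itinerary G l 0 xs"
  shows "emeasure P (cylinder G l 0 xs) = path_prob G \<sigma> 0 (i, \<one>\<^bsub>G\<^esub>) xs"
  using assms unfolding walk_law_def itinerary_def cylinder_def by simp

lemma walk_law_Suc_cylinder:
  assumes "walk_law G l \<sigma> (Suc m) i P" "itinerary G l (Suc m) xs"
  shows "emeasure P (cylinder G l m ((i, \<one>\<^bsub>G\<^esub>) # xs)) = path_prob G \<sigma> (Suc m) (i, \<one>\<^bsub>G\<^esub>) xs"
proof -
  have "cylinder G l m ((i, \<one>\<^bsub>G\<^esub>) # xs) =
      {\<omega> \<in> paths G l. (\<forall>m'. Suc m = Suc m' \<longrightarrow> \<omega> m' = (i, \<one>\<^bsub>G\<^esub>)) \<and> (\<forall>r<length xs. \<omega> (Suc m + r) = xs ! r)}"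
    by (auto simp: cylinder_Cons) (auto simp: cylinder_def)
  then show ?thesis
    using assms by (simp add: walk_law_def itinerary_def)
qed

text \<open>A walk started at \<open>(i, e)\<close> at time \<open>m\<close> almost surely is there at that time, so that the cylinders with
  another first state are null.\<close>

lemma walk_law_Suc_other:
  assumes P: "walk_law G l \<sigma> (Suc m) i P" and G: "countable (carrier G)"
    and xs: "itinerary G l m (x # xs)" "x \<noteq> (i, \<one>\<^bsub>G\<^esub>)" and i: "(i, \<one>\<^bsub>G\<^esub>) \<in> states G l m"
  shows "emeasure P (cylinder G l m (x # xs)) = 0"
proof -
  interpret P: prob_space P using P by (simp add: walk_law_def)
  have sets_P: "sets P = sigma_sets (paths G l) (cylinders G l m)"
    using P by (simp add: walk_law_def coords_from_eq_cylinders[OF G])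
  have sets: "cylinder G l m ys \<in> sets P" if "itinerary G l m ys" for ys
    unfolding sets_P using that by (intro sigma_sets.Basic) (auto simp: cylinders_def)
  have "emeasure P (cylinder G l m [(i, \<one>\<^bsub>G\<^esub>)]) = 1"
    using walk_law_Suc_cylinder[OF P, of "[]"] by simp
  then have "AE \<omega> in P. \<omega> \<in> cylinder G l m [(i, \<one>\<^bsub>G\<^esub>)]"
    using sets[of "[(i, \<one>\<^bsub>G\<^esub>)]"] i by (intro P.AE_in_set_eq_1[THEN iffD2]) (auto simp: P.emeasure_eq_measure)
  then have "AE \<omega> in P. \<omega> \<notin> cylinder G l m (x # xs)"
    by eventually_elim (use xs in \<open>auto simp: cylinder_Cons\<close>)
  then show ?thesis
    using sets[OF xs(1)] by (simp add: AE_iff_null_sets[symmetric] null_setsD1)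
qed

lemma measurable_ident_sets':
  assumes "sets N \<subseteq> sets M" "space M = space N"
  shows "(\<lambda>x. x) \<in> measurable M N"
proof (rule measurableI)
  show "(\<lambda>x. x) -` A \<inter> space M \<in> sets M" if "A \<in> sets N" for A
    using assms that sets.sets_into_space[OF that] by (auto simp: Int_absorb2)
qed (use assms in simp)

text \<open>The coordinates from time \<open>m\<close> on, as a measurable space. It carries the zero measure, which plays
  no role.\<close>

definition coord_algebra ::
  "('g, 'r) monoid_scheme \<Rightarrow> (nat \<Rightarrow> nat) \<Rightarrow> nat \<Rightarrow> (nat \<Rightarrow> nat \<times> 'g) measure" where
  "coord_algebra G l m = sigma (paths G l) (coords_from G l m)"

lemma space_coord_algebra [simp]: "space (coord_algebra G l m) = paths G l"
  by (simp add: coord_algebra_def space_measure_of_conv)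

lemma coords_from_subset: "coords_from G l m \<subseteq> Pow (paths G l)"
  unfolding coords_from_def by (intro sigma_sets_subset_Pow) auto

lemma sets_coord_algebra: "sets (coord_algebra G l m) = coords_from G l m"
proof -
  have "sigma_sets (paths G l) (coords_from G l m) = coords_from G l m"
    unfolding coords_from_def by (rule sigma_sets_sigma_sets_eq) auto
  then show ?thesis
    using coords_from_subset[of G l m] by (simp add: coord_algebra_def sets_measure_of_conv)
qed

lemma (in group) path_act_measurable:
  assumes G: "countable (carrier G)" and g: "g \<in> carrier G"
  shows "path_act G g \<in> measurable (coord_algebra G l m) (coord_algebra G l m)"
proof (rule measurable_sigma_sets)
  show "sets (coord_algebra G l m) = sigma_sets (paths G l) (cylinders G l m)"
    by (simp add: sets_coord_algebra coords_from_eq_cylinders[OF G])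
  show "path_act G g \<in> space (coord_algebra G l m) \<rightarrow> paths G l"
    using path_act_in_paths[OF g] by auto
  fix A assume "A \<in> cylinders G l m"
  then have "path_act G g -` A \<inter> paths G l \<in> cylinders G l m"
    using path_act_vimage_cylinder[OF g, of l m] itinerary_lshift[of "inv g" l m] g
    by (auto simp: cylinders_def)
  then show "path_act G g -` A \<inter> space (coord_algebra G l m) \<in> sets (coord_algebra G l m)"
    by (auto simp: sets_coord_algebra coords_from_eq_cylinders[OF G])
qed (rule cylinders_subset)

text \<open>The Markov property: the walk restricted to the event that its first states are \<open>xs\<close> followed by
  \<open>(j, g)\<close> is, from time \<open>m\<close> on, the \<open>g\<close>-translate of the walk started at \<open>(j, e)\<close> at time \<open>m\<close>, multiplied
  by the probability of the event. Both sides are compared on cylinders. The remaining conclusions are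
  the measurability of the two maps involved.\<close>

lemma (in group) walk_markov:
  fixes l \<sigma> m
  defines "R \<equiv> coord_algebra G l m"
  assumes G: "countable (carrier G)"
    and P0: "walk_law G l \<sigma> 0 0 P0" and P: "walk_law G l \<sigma> (Suc m) j P"
    and p: "itinerary G l 0 (xs @ [(j, g)])" "length xs = m"
  shows "distr (density P0 (indicator (cylinder G l 0 (xs @ [(j, g)])))) R (\<lambda>\<omega>. \<omega>) =
    density (distr P R (path_act G g)) (\<lambda>_. path_prob G \<sigma> 0 (0, \<one>) (xs @ [(j, g)]))"
    (is "?L = density _ (\<lambda>_. ?c)")
    and "(\<lambda>\<omega>. \<omega>) \<in> measurable P0 R" and "path_act G g \<in> measurable P R"
proof -
  let ?C = "cylinder G l 0 (xs @ [(j, g)])"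
  have g: "g \<in> carrier G" and j: "(j, \<one>) \<in> states G l m"
    using p by (auto simp: itinerary_append states_def)
  interpret P0: prob_space P0 using P0 by (simp add: walk_law_def)
  interpret P: prob_space P using P by (simp add: walk_law_def)
  have R: "sets R = sigma_sets (paths G l) (cylinders G l m)" "space R = paths G l"
    by (simp_all add: R_def sets_coord_algebra coords_from_eq_cylinders[OF G])
  have sets_P: "sets P = sets R" and space_P: "space P = paths G l"
    using P R by (auto simp: walk_law_def coords_from_eq_cylinders[OF G])
  have sets_P0: "sets P0 = sigma_sets (paths G l) (cylinders G l 0)" and space_P0: "space P0 = paths G l"
    using P0 by (auto simp: walk_law_def coords_from_eq_cylinders[OF G])
  have cyl0: "cylinder G l 0 ys \<in> sets P0" if "itinerary G l 0 ys" for ys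
    unfolding sets_P0 using that by (intro sigma_sets.Basic) (auto simp: cylinders_def)
  have cyl: "cylinder G l m ys \<in> sets R" if "itinerary G l m ys" for ys
    unfolding R using that by (intro sigma_sets.Basic) (auto simp: cylinders_def)
  have "coords_from G l m \<subseteq> coords_from G l 0"
    unfolding coords_from_def by (intro sigma_sets_mono') auto
  then show id: "(\<lambda>\<omega>. \<omega>) \<in> measurable P0 R"
    unfolding coords_from_eq_cylinders[OF G] R(1)[symmetric] sets_P0[symmetric]
    by (intro measurable_ident_sets') (auto simp: R space_P0)
  show act: "path_act G g \<in> measurable P R"
    using path_act_measurable[OF G g, of l m] sets_P
    by (simp add: R_def[symmetric] cong: measurable_cong_sets)
  have emeasure_L: "emeasure ?L D = emeasure P0 (?C \<inter> D)" if D: "D \<in> sets R" for D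
  proof -
    have vimage: "(\<lambda>\<omega>. \<omega>) -` D \<inter> space P0 = D"
      using sets.sets_into_space[OF D] by (auto simp: R space_P0)
    then have "D \<in> sets P0" using measurable_sets[OF id D] by simp
    moreover have "emeasure ?L D = emeasure (density P0 (indicator ?C)) D"
      using vimage id D by (subst emeasure_distr) auto
    ultimately show ?thesis using cyl0[OF p(1)] by (simp add: emeasure_restricted)
  qed
  show "?L = density (distr P R (path_act G g)) (\<lambda>_. ?c)"
  proof (rule measure_eqI_generator_eq[OF Int_stable_cylinders cylinders_subset, where A = "\<lambda>_. paths G l"])
    fix D assume "D \<in> cylinders G l m"
    then consider "D = {}" | ys where "D = cylinder G l m ys" "itinerary G l m ys"
      by (auto simp: cylinders_def)
    then show "emeasure ?L D = emeasure (density (distr P R (path_act G g)) (\<lambda>_. ?c)) D"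
    proof cases
      case 2
      have D: "D \<in> sets R" using cyl 2 by simp
      have L: "emeasure ?L D = emeasure P0 (?C \<inter> D)" using D by (rule emeasure_L)
      have Rr: "emeasure (density (distr P R (path_act G g)) (\<lambda>_. ?c)) D =
          ?c * emeasure P (cylinder G l m (map (lshift G (inv g)) ys))"
        using D act 2 path_act_vimage_cylinder[OF g, of l m ys]
        by (simp add: emeasure_density nn_integral_cmult_indicator emeasure_distr space_P)
      show ?thesis
      proof (cases ys)
        case Nil
        have "emeasure P0 ?C = ?c" by (rule walk_law_0_cylinder[OF P0 p(1)])
        then show ?thesis
          using L Rr Nil 2 cylinder_subset[of G l 0 "xs @ [(j, g)]"] P.emeasure_space_1
          by (simp add: space_P Int_absorb2)
      next
        case (Cons y zs)
        show ?thesis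
        proof (cases "y = (j, g)")
          case True
          have "?C \<inter> D = cylinder G l 0 ((xs @ [(j, g)]) @ zs)"
            using p True Cons 2 by (auto simp: cylinder_append cylinder_Cons)
          moreover have "itinerary G l 0 ((xs @ [(j, g)]) @ zs)"
            using p Cons 2 by (auto simp: itinerary_append)
          ultimately have "emeasure P0 (?C \<inter> D) = path_prob G \<sigma> 0 (0, \<one>) ((xs @ [(j, g)]) @ zs)"
            using walk_law_0_cylinder[OF P0] by metis
          also have "\<dots> = ?c * path_prob G \<sigma> (Suc m) (j, g) zs"
            using p by (subst path_prob_append) auto
          also have "path_prob G \<sigma> (Suc m) (j, g) zs =
              path_prob G \<sigma> (Suc m) (j, \<one>) (map (lshift G (inv g)) zs)"
            using path_prob_lshift[of "inv g" "(j, g)" l "Suc m" zs \<sigma> "Suc m"] g Cons 2 by simp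
          also have "\<dots> = emeasure P (cylinder G l m ((j, \<one>) # map (lshift G (inv g)) zs))"
            using Cons 2 g
            by (intro walk_law_Suc_cylinder[OF P, symmetric] itinerary_lshift) auto
          finally show ?thesis
            using L Rr Cons True g by simp
        next
          case False
          have "?C \<inter> D = {}"
            using p False Cons 2 by (auto simp: cylinder_append cylinder_Cons)
          moreover have "emeasure P (cylinder G l m (lshift G (inv g) y # map (lshift G (inv g)) zs)) = 0"
          proof (rule walk_law_Suc_other[OF P G _ _ j])
            show "itinerary G l m (lshift G (inv g) y # map (lshift G (inv g)) zs)"
              using itinerary_lshift[of "inv g" l m ys] g 2 Cons by simp
            have "snd y \<in> carrier G" using 2 Cons by (auto simp: states_def)
            then show "lshift G (inv g) y \<noteq> (j, \<one>)"
              using False g by (auto simp: prod_eq_iff inv_solve_left')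
          qed
          ultimately show ?thesis
            using L Rr Cons by simp
        qed
      qed
    qed simp
  next
    show "emeasure ?L (paths G l) \<noteq> \<infinity>" for i :: nat
      using emeasure_L[of "paths G l"] sets.top[of R] by (simp add: R(2))
  qed (use R paths_in_cylinders in auto)
qed

section \<open>Absolute continuity along a stationary system\<close>

lemma integral_eq_0_parts:
  fixes f :: "'a \<Rightarrow> real"
  assumes "integrable M f" "(\<integral>x. f x \<partial>M) = 0"
  shows "(\<integral>\<^sup>+x. ennreal (f x) \<partial>M) = (\<integral>\<^sup>+x. ennreal (- f x) \<partial>M)"
    and "(\<integral>\<^sup>+x. ennreal (f x) \<partial>M) < \<infinity>"
proof -
  obtain r q where "0 \<le> r" "0 \<le> q" "(\<integral>\<^sup>+x. ennreal (f x) \<partial>M) = ennreal r"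
    "(\<integral>\<^sup>+x. ennreal (- f x) \<partial>M) = ennreal q" "(\<integral>x. f x \<partial>M) = r - q"
    using assms(1) by (rule integrableE)
  then show "(\<integral>\<^sup>+x. ennreal (f x) \<partial>M) = (\<integral>\<^sup>+x. ennreal (- f x) \<partial>M)"
    "(\<integral>\<^sup>+x. ennreal (f x) \<partial>M) < \<infinity>"
    using assms(2) by simp_all
qed

text \<open>The hypotheses on the group and on the stochastic sequence, in the form used throughout\<close>

locale stochastic_walk = group G for G :: "('g, 'r) monoid_scheme" (structure) +
  fixes l :: "nat \<Rightarrow> nat" and \<sigma> :: "nat \<Rightarrow> nat \<Rightarrow> nat \<Rightarrow> 'g measure"
  assumes countable_G: "countable (carrier G)"
    and stochastic: "stochastic_sequence G l \<sigma>"
    and full_support: "\<And>j g. j < l 0 \<Longrightarrow> g \<in> carrier G \<Longrightarrow> 0 < emeasure (\<sigma> 0 0 j) {g}"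
    and no_zero_columns: "no_zero_columns G l \<sigma>"
begin

lemma act_measurable_fam:
  assumes "sigma_system G l \<sigma> X" "j < dim_at l k" "g \<in> carrier G"
  shows "act X g \<in> measurable (fam X k j) (alg X)"
  using assms measurable_actionD(1)[OF sigma_systemD(1)[OF assms(1)] assms(3)] sigma_systemD(3)[OF assms(1,2)]
  by (simp cong: measurable_cong_sets)

lemma emeasure_translate_vimage:
  assumes X: "sigma_system G l \<sigma> X" and j: "j < dim_at l k" and g: "g \<in> carrier G" and h: "h \<in> carrier G"
    and N: "N \<in> sets (alg X)"
  shows "emeasure (translate X h (fam X k j)) (act X g -` N \<inter> space (alg X)) =
    emeasure (translate X (g \<otimes> h) (fam X k j)) N"
proof -
  note A = measurable_actionD[OF sigma_systemD(1)[OF X]]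
  have "act X (g \<otimes> h) -` N \<inter> space (fam X k j) =
      act X h -` (act X g -` N \<inter> space (alg X)) \<inter> space (fam X k j)"
    using A(3)[OF g h] measurable_space[OF A(1)[OF h]] sigma_systemD(4)[OF X j] by auto
  then show ?thesis
    using measurable_sets[OF A(1)[OF g] N] act_measurable_fam[OF X j] g h N
    by (simp add: emeasure_distr)
qed

lemma translate_one:
  assumes X: "sigma_system G l \<sigma> X" and j: "j < dim_at l k"
  shows "translate X \<one> (fam X k j) = fam X k j"
proof -
  have "translate X \<one> (fam X k j) = distr (fam X k j) (fam X k j) (\<lambda>x. x)"
    using measurable_actionD(2)[OF sigma_systemD(1)[OF X]] sigma_systemD(3,4)[OF X j]
    by (intro distr_cong) auto
  then show ?thesis by simp
qed

text \<open>A set that is null for a measure of the system is null for every translate that occurs with positive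
  weight in the decomposition of this measure given by stationarity.\<close>

lemma null_step:
  assumes X: "sigma_system G l \<sigma> X" and "i < dim_at l n" "j < l n" "h \<in> carrier G"
    and "0 < emeasure (\<sigma> n i j) {h}"
    and A: "A \<in> sets (alg X)" "emeasure (fam X n i) A = 0"
  shows "emeasure (translate X h (fam X (Suc n) j)) A = 0"
proof -
  have "(\<Sum>j<l n. conv_emeasure G X (\<sigma> n i j) (fam X (Suc n) j) A) = 0"
    using X A assms(2) unfolding sigma_system_def by metis
  then have "conv_emeasure G X (\<sigma> n i j) (fam X (Suc n) j) A = 0"
    using assms(3) by simp
  then show ?thesis
    using assms(4,5) by (auto simp: conv_emeasure_def nn_integral_0_iff_AE AE_count_space)
qed

text \<open>The support hypotheses make every translate of every measure of the family absolutely
  continuous with respect to \<open>fam X 0 0\<close>.\<close>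

lemma translate_null:
  assumes X: "sigma_system G l \<sigma> X" and N: "N \<in> sets (alg X)" "emeasure (fam X 0 0) N = 0"
    and "j < dim_at l k" "g \<in> carrier G"
  shows "emeasure (translate X g (fam X k j)) N = 0"
  using assms(4,5)
proof (induction k arbitrary: j g)
  case 0
  then have j: "j = 0" by (simp add: dim_at_def)
  note A = measurable_actionD[OF sigma_systemD(1)[OF X]]
  have one: "emeasure (translate X h (fam X (Suc 0) j)) N = 0" if "j < l 0" "h \<in> carrier G" for j h
    using that N full_support by (intro null_step[OF X, of 0]) (auto simp: dim_at_def)
  have gN: "act X g -` N \<inter> space (alg X) \<in> sets (alg X)"
    using A(1)[OF 0(2)] N(1) by (rule measurable_sets)
  have "emeasure (fam X 0 0) (act X g -` N \<inter> space (alg X)) = 0"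
  proof -
    have "conv_emeasure G X (\<sigma> 0 0 j) (fam X (Suc 0) j) (act X g -` N \<inter> space (alg X)) = 0" if "j < l 0" for j
    proof -
      have "emeasure (translate X h (fam X (Suc 0) j)) (act X g -` N \<inter> space (alg X)) = 0"
        if "h \<in> carrier G" for h
        using emeasure_translate_vimage[OF X _ 0(2) that N(1), of j "Suc 0"] one[OF \<open>j < l 0\<close>] 0(2) that \<open>j < l 0\<close>
        by (simp add: dim_at_def)
      then show ?thesis
        by (simp add: conv_emeasure_def nn_integral_0_iff_AE AE_count_space)
    qed
    then have "(\<Sum>j<l 0. conv_emeasure G X (\<sigma> 0 0 j) (fam X (Suc 0) j) (act X g -` N \<inter> space (alg X))) = 0"
      by simp
    then show ?thesis
      using X gN 0(1) j unfolding sigma_system_def by metis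
  qed
  then show ?case
    using emeasure_distr[OF act_measurable_fam[OF X 0(1,2)] N(1)] sigma_systemD(4)[OF X 0(1)] j by simp
next
  case (Suc n)
  have j: "j < l n" using Suc.prems by (simp add: dim_at_def)
  show ?case
  proof (cases n)
    case 0
    have "emeasure (translate X g (fam X (Suc 0) j)) N = 0"
      using 0 j N Suc.prems full_support by (intro null_step[OF X, of 0 0]) (auto simp: dim_at_def)
    then show ?thesis using 0 by simp
  next
    case (Suc n')
    obtain i where i: "i < dim_at l n" "0 < emeasure (\<sigma> n i j) (carrier G)"
      using no_zero_columns j by (auto simp: no_zero_columns_def)
    have sets: "sets (\<sigma> n i j) = sets (count_space (carrier G))"
      using stochastic i j by (auto simp: stochastic_sequence_def)
    have "\<exists>h\<in>carrier G. 0 < emeasure (\<sigma> n i j) {h}"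
    proof (rule ccontr)
      assume "\<not> ?thesis"
      then have "(\<integral>\<^sup>+h. emeasure (\<sigma> n i j) {h} \<partial>count_space (carrier G)) = 0"
        by (simp add: nn_integral_0_iff_AE AE_count_space)
      moreover have "emeasure (\<sigma> n i j) (carrier G) = (\<integral>\<^sup>+h. emeasure (\<sigma> n i j) {h} \<partial>count_space (carrier G))"
        using countable_G by (intro emeasure_countable_singleton) (auto simp: sets)
      ultimately show False using i by simp
    qed
    then obtain h where h: "h \<in> carrier G" "0 < emeasure (\<sigma> n i j) {h}" by blast
    \<comment> \<open>The induction hypothesis for \<open>g h\<inverse>\<close> yields the claim for \<open>g\<close>, since \<open>h\<close> has positive weight.\<close>
    let ?g = "g \<otimes> inv h"
    have g: "?g \<in> carrier G" "?g \<otimes> h = g" using Suc.prems h by (auto simp: m_assoc)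
    let ?A = "act X ?g -` N \<inter> space (alg X)"
    have A: "?A \<in> sets (alg X)"
      using measurable_actionD(1)[OF sigma_systemD(1)[OF X] g(1)] N(1) by (rule measurable_sets)
    have "emeasure (fam X n i) ?A = 0"
      using Suc.IH[OF i(1) g(1)] emeasure_distr[OF act_measurable_fam[OF X i(1) g(1)] N(1)]
        sigma_systemD(4)[OF X i(1)] by simp
    then have "emeasure (translate X h (fam X (Suc n) j)) ?A = 0"
      using null_step[OF X i(1) j h A] by simp
    then show ?thesis
      using emeasure_translate_vimage[OF X Suc.prems(1) g(1) h(1) N(1)] g by simp
  qed
qed

lemma AE_translate:
  assumes X: "sigma_system G l \<sigma> X" and ae: "AE x in fam X 0 0. Q x"
    and j: "j < dim_at l k" and g: "g \<in> carrier G"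
  shows "AE x in translate X g (fam X k j). Q x"
proof -
  have d0: "0 < dim_at l 0" by (simp add: dim_at_def)
  obtain N where N: "{x \<in> space (fam X 0 0). \<not> Q x} \<subseteq> N" "emeasure (fam X 0 0) N = 0" "N \<in> sets (fam X 0 0)"
    using ae by (rule AE_E)
  then have "N \<in> null_sets (translate X g (fam X k j))"
    using translate_null[OF X _ _ j g, of N] sigma_systemD(3)[OF X d0] by auto
  then show ?thesis
    using N(1) sigma_systemD(4)[OF X d0] by (intro AE_I'[of N]) auto
qed

lemma AE_fam:
  assumes "sigma_system G l \<sigma> X" "AE x in fam X 0 0. Q x" "j < dim_at l k"
  shows "AE x in fam X k j. Q x"
  using AE_translate[OF assms one_closed] unfolding translate_one[OF assms(1,3)] .

end

section \<open>Functions on the Poisson boundary are determined by their integrals\<close>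

context stochastic_walk begin

text \<open>A bounded function on the boundary is zero almost everywhere if all its integrals against the translates of the
  measures of the boundary vanish. No martingale convergence is needed: the corresponding tail function
  \<open>F\<close> integrates to zero over every cylinder, so its positive and negative parts are densities of the same
  measure.\<close>

lemma boundary_function_zero:
  assumes B: "poisson_boundary G l \<sigma> B"
    and f: "f \<in> borel_measurable (alg B)" "\<And>b. b \<in> space (alg B) \<Longrightarrow> \<bar>f b\<bar> \<le> K"
    and zero: "\<And>k j g. j < dim_at l k \<Longrightarrow> g \<in> carrier G \<Longrightarrow> (\<integral>b. f (act B g b) \<partial>fam B k j) = 0"
  shows "AE b in fam B 0 0. f b = (0::real)"
proof -
  have d0: "0 < dim_at l 0" by (simp add: dim_at_def)
  have X: "sigma_system G l \<sigma> B"
    using B by (simp add: poisson_boundary_def regular_system_def)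
  note A = measurable_actionD[OF sigma_systemD(1)[OF X]]
  obtain P T where P: "\<And>k j. j < dim_at l k \<Longrightarrow> walk_law G l \<sigma> k j (P k j)"
    and T: "Linf_iso (fam B 0 0) (restr_to_subalg (P 0 0) (tail_algebra G l)) T"
    and equiv: "\<And>f g. f \<in> Linf (fam B 0 0) \<Longrightarrow> g \<in> carrier G \<Longrightarrow>
       AE \<omega> in restr_to_subalg (P 0 0) (tail_algebra G l).
         T (\<lambda>b. f (act B (inv g) b)) \<omega> = T f (path_act G (inv g) \<omega>)"
    and int: "\<And>f k j. f \<in> Linf (fam B 0 0) \<Longrightarrow> j < dim_at l k \<Longrightarrow>
       (\<integral>b. f b \<partial>fam B k j) = (\<integral>\<omega>. T f \<omega> \<partial>P k j)"
    using B by (simp add: poisson_boundary_def Let_def) blast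
  let ?N = "restr_to_subalg (P 0 0) (tail_algebra G l)"
  interpret P0: prob_space "P 0 0" using P[OF d0] by (simp add: walk_law_def)
  have sets_P0: "sets (P 0 0) = sets (coord_algebra G l 0)" and space_P0: "space (P 0 0) = paths G l"
    using P[OF d0] by (simp_all add: walk_law_def sets_coord_algebra)
  have tail: "space (tail_algebra G l) = paths G l" "sets (tail_algebra G l) \<subseteq> sets (coord_algebra G l m)" for m
  proof -
    show "space (tail_algebra G l) = paths G l"
      by (simp add: tail_algebra_def space_measure_of_conv)
    have "(\<Inter>m. coords_from G l m) \<subseteq> Pow (paths G l)" using coords_from_subset by blast
    then show "sets (tail_algebra G l) \<subseteq> sets (coord_algebra G l m)"
      by (simp add: tail_algebra_def sets_measure_of_conv sets_coord_algebra[symmetric])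
        (metis (no_types, lifting) INT_lower UNIV_I sets.sigma_sets_subset space_coord_algebra sets_coord_algebra)
  qed
  have sub: "subalgebra (P 0 0) (tail_algebra G l)"
    using tail by (simp add: subalgebra_def sets_P0 space_P0)
  have coord: "u \<in> borel_measurable (coord_algebra G l m)" if "u \<in> Linf ?N" for u m
  proof -
    have "u \<in> borel_measurable (tail_algebra G l)"
      using that measurable_in_subalg'[OF sub] by (auto simp: Linf_def)
    moreover have "subalgebra (coord_algebra G l m) (tail_algebra G l)"
      using tail by (simp add: subalgebra_def)
    ultimately show ?thesis by (metis measurable_from_subalg)
  qed
  have Linf: "(\<lambda>b. f (act B g b)) \<in> Linf (fam B 0 0)" if "g \<in> carrier G" for g
    using f measurable_compose[OF A(1)[OF that] f(1)] measurable_space[OF A(1)[OF that]]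
      sigma_systemD(3,4)[OF X d0]
    by (auto simp: Linf_def intro!: exI[of _ K] cong: measurable_cong_sets)
  have Lf: "f \<in> Linf (fam B 0 0)"
    using f sigma_systemD(3,4)[OF X d0]
    by (auto simp: Linf_def intro!: exI[of _ K] cong: measurable_cong_sets)
  have TL: "T u \<in> Linf ?N" if "u \<in> Linf (fam B 0 0)" for u
    using T that by (auto simp: Linf_iso_def)
  have T_cong: "(AE b in fam B 0 0. u b = v b) \<longleftrightarrow> (AE \<omega> in ?N. T u \<omega> = T v \<omega>)"
    if "u \<in> Linf (fam B 0 0)" "v \<in> Linf (fam B 0 0)" for u v
    using T that by (auto simp: Linf_iso_def)
  \<comment> \<open>The tail function that corresponds to \<open>f\<close>\<close>
  define F where "F = T f"
  have F: "F \<in> borel_measurable (P 0 0)"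
    using coord[OF TL[OF Lf], of 0] by (simp add: F_def sets_P0 cong: measurable_cong_sets)
  obtain K' where "AE \<omega> in ?N. \<bar>F \<omega>\<bar> \<le> K'"
    using TL[OF Lf] by (auto simp: Linf_def F_def)
  then have bound: "AE \<omega> in P 0 0. \<bar>F \<omega>\<bar> \<le> K'" by (rule AE_restr_to_subalg[OF sub])
  \<comment> \<open>Equivariance of \<open>T\<close>, read in the direction that expresses \<open>F\<close> by the translated function: this
     spares a comparison of the laws of the walk started later with the Markov measure.\<close>
  have moved: "AE \<omega> in P 0 0. F \<omega> = T (\<lambda>b. f (act B g b)) (path_act G (inv g) \<omega>)" if g: "g \<in> carrier G" for g
  proof -
    let ?u = "\<lambda>b. f (act B g b)"
    have "AE b in fam B 0 0. ?u (act B (inv g) b) = f b"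
      using A(5)[OF g] sigma_systemD(4)[OF X d0] by (auto intro!: AE_I2)
    moreover have "(\<lambda>b. ?u (act B (inv g) b)) \<in> Linf (fam B 0 0)"
    proof -
      have "(\<lambda>b. ?u (act B (inv g) b)) \<in> borel_measurable (alg B)"
        using g by (intro measurable_compose[OF A(1) measurable_compose[OF A(1) f(1)]]) auto
      then show ?thesis
        using f(2) g sigma_systemD(3,4)[OF X d0] measurable_space[OF A(1)]
        by (auto simp: Linf_def intro!: exI[of _ K] cong: measurable_cong_sets)
    qed
    ultimately have "AE \<omega> in ?N. T (\<lambda>b. ?u (act B (inv g) b)) \<omega> = F \<omega>"
      using T_cong[OF _ Lf] by (simp add: F_def)
    with equiv[OF Linf[OF g] g] have "AE \<omega> in ?N. F \<omega> = T ?u (path_act G (inv g) \<omega>)"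
      by eventually_elim simp
    then show ?thesis by (rule AE_restr_to_subalg[OF sub])
  qed
  have cyl_sets: "cylinder G l 0 xs \<in> sets (P 0 0)" if "itinerary G l 0 xs" for xs
    using that by (auto simp: sets_P0 sets_coord_algebra coords_from_eq_cylinders[OF countable_G] cylinders_def)
  have cyl_zero: "(\<integral>\<omega>. indicator (cylinder G l 0 xs) \<omega> * F \<omega> \<partial>P 0 0) = 0"
    if xs: "itinerary G l 0 xs" for xs
  proof (cases xs rule: rev_cases)
    case Nil
    have "(\<integral>\<omega>. indicator (cylinder G l 0 xs) \<omega> * F \<omega> \<partial>P 0 0) = (\<integral>\<omega>. F \<omega> \<partial>P 0 0)"
      using Nil by (intro Bochner_Integration.integral_cong) (auto simp: space_P0)
    also have "\<dots> = (\<integral>b. f b \<partial>fam B 0 0)"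
      using int[OF Lf d0] by (simp add: F_def)
    also have "\<dots> = (\<integral>b. f (act B \<one> b) \<partial>fam B 0 0)"
      using A(2) sigma_systemD(4)[OF X d0] by (intro Bochner_Integration.integral_cong) auto
    finally show ?thesis using zero[OF d0 one_closed] by simp
  next
    case (snoc ys x)
    obtain j g where x: "x = (j, g)" by (cases x)
    define m where "m = length ys"
    let ?C = "cylinder G l 0 xs" and ?R = "coord_algebra G l m" and ?Q = "P (Suc m) j"
    let ?u = "T (\<lambda>b. f (act B g b))"
    have g: "g \<in> carrier G" and j: "j < dim_at l (Suc m)"
      using xs by (auto simp: snoc x itinerary_append states_def dim_at_def m_def)
    have xs_eq: "xs = ys @ [(j, g)]" using snoc x by simp
    note M = walk_markov[OF countable_G P[OF d0] P[OF j] xs[unfolded xs_eq] m_def[symmetric], folded xs_eq]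
    have H: "(\<lambda>\<omega>. ?u (path_act G (inv g) \<omega>)) \<in> borel_measurable ?R"
      using g by (intro measurable_compose[OF path_act_measurable[OF countable_G] coord[OF TL[OF Linf]]]) auto
    have HP: "(\<lambda>\<omega>. ?u (path_act G (inv g) \<omega>)) \<in> borel_measurable (P 0 0)"
      using measurable_compose[OF M(2) H] .
    let ?c = "path_prob G \<sigma> 0 (0, \<one>) xs"
    have "?c = emeasure (P 0 0) ?C"
      using walk_law_0_cylinder[OF P[OF d0] xs] by simp
    then obtain c where c: "?c = ennreal c" "0 \<le> c"
      by (simp add: P0.emeasure_eq_measure)
    have "(\<integral>\<omega>. indicator ?C \<omega> * F \<omega> \<partial>P 0 0) =
        (\<integral>\<omega>. indicator ?C \<omega> * ?u (path_act G (inv g) \<omega>) \<partial>P 0 0)"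
      using moved[OF g] HP F cyl_sets[OF xs]
      by (intro integral_cong_AE) (auto elim!: eventually_mono)
    also have "\<dots> = (\<integral>\<omega>. ?u (path_act G (inv g) \<omega>) \<partial>density (P 0 0) (indicator ?C))"
      using integral_density[OF HP, of "indicator ?C"] cyl_sets[OF xs] by (simp add: ennreal_indicator)
    also have "\<dots> = (\<integral>\<omega>. ?u (path_act G (inv g) \<omega>) \<partial>distr (density (P 0 0) (indicator ?C)) ?R (\<lambda>\<omega>. \<omega>))"
      using H M(2) by (intro integral_distr[symmetric]) auto
    also have "\<dots> = (\<integral>\<omega>. ?u (path_act G (inv g) \<omega>) \<partial>density (distr ?Q ?R (path_act G g)) (\<lambda>_. ennreal c))"
      by (simp only: M(1) c)
    also have "\<dots> = (\<integral>\<omega>. c * ?u (path_act G (inv g) \<omega>) \<partial>distr ?Q ?R (path_act G g))"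
      using H c by (subst integral_density) auto
    also have "\<dots> = (\<integral>\<omega>. c * ?u (path_act G (inv g) (path_act G g \<omega>)) \<partial>?Q)"
      using H M(3) by (subst integral_distr) auto
    also have "\<dots> = (\<integral>\<omega>. c * ?u \<omega> \<partial>?Q)"
      using P[OF j] g by (intro Bochner_Integration.integral_cong) (auto simp: walk_law_def path_act_inverse)
    also have "\<dots> = c * (\<integral>b. f (act B g b) \<partial>fam B (Suc m) j)"
      using int[OF Linf[OF g] j] by simp
    finally show ?thesis using zero[OF j g] by simp
  qed
  have int_F: "integrable (P 0 0) (\<lambda>\<omega>. indicator A \<omega> * F \<omega>)" if "A \<in> sets (P 0 0)" for A
    using that F bound
    by (intro P0.integrable_const_bound[of _ "\<bar>K'\<bar>"])
       (auto elim!: eventually_mono simp: indicator_def)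
  have parts: "(\<integral>\<^sup>+\<omega>. ennreal (F \<omega>) * indicator A \<omega> \<partial>P 0 0) = (\<integral>\<^sup>+\<omega>. ennreal (- F \<omega>) * indicator A \<omega> \<partial>P 0 0)"
    and fin: "(\<integral>\<^sup>+\<omega>. ennreal (F \<omega>) * indicator A \<omega> \<partial>P 0 0) < \<infinity>"
    if A: "A \<in> sets (P 0 0)" "(\<integral>\<omega>. indicator A \<omega> * F \<omega> \<partial>P 0 0) = 0" for A
  proof -
    have eqs: "ennreal (F \<omega>) * indicator A \<omega> = ennreal (indicator A \<omega> * F \<omega>)"
      "ennreal (- F \<omega>) * indicator A \<omega> = ennreal (- (indicator A \<omega> * F \<omega>))" for \<omega>
      by (cases "\<omega> \<in> A"; simp)+
    show "(\<integral>\<^sup>+\<omega>. ennreal (F \<omega>) * indicator A \<omega> \<partial>P 0 0) = (\<integral>\<^sup>+\<omega>. ennreal (- F \<omega>) * indicator A \<omega> \<partial>P 0 0)"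
      "(\<integral>\<^sup>+\<omega>. ennreal (F \<omega>) * indicator A \<omega> \<partial>P 0 0) < \<infinity>"
      unfolding eqs using integral_eq_0_parts[OF int_F[OF A(1)] A(2)] by blast+
  qed
  have "density (P 0 0) (\<lambda>\<omega>. ennreal (F \<omega>)) = density (P 0 0) (\<lambda>\<omega>. ennreal (- F \<omega>))"
  proof (rule measure_eqI_generator_eq[OF Int_stable_cylinders[of G l 0] cylinders_subset, where A = "\<lambda>_. paths G l"])
    fix D assume "D \<in> cylinders G l 0"
    then consider "D = {}" | xs where "D = cylinder G l 0 xs" "itinerary G l 0 xs"
      by (auto simp: cylinders_def)
    then show "emeasure (density (P 0 0) (\<lambda>\<omega>. ennreal (F \<omega>))) D = emeasure (density (P 0 0) (\<lambda>\<omega>. ennreal (- F \<omega>))) D"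
      using F cyl_sets cyl_zero parts by cases (simp_all add: emeasure_density)
  next
    have "(\<integral>\<omega>. indicator (paths G l) \<omega> * F \<omega> \<partial>P 0 0) = 0" "paths G l \<in> sets (P 0 0)"
      using cyl_zero[of "[]"] cyl_sets[of "[]"] by simp_all
    then show "emeasure (density (P 0 0) (\<lambda>\<omega>. ennreal (F \<omega>))) (paths G l) \<noteq> \<infinity>" for i :: nat
      using F fin by (simp add: emeasure_density less_top)
  qed (use paths_in_cylinders in \<open>auto simp: sets_P0 sets_coord_algebra coords_from_eq_cylinders[OF countable_G]\<close>)
  then have "AE \<omega> in P 0 0. ennreal (F \<omega>) = ennreal (- F \<omega>)"
    using F by (intro P0.density_unique) auto
  then have F0: "AE \<omega> in P 0 0. F \<omega> = 0"
    by eventually_elim (metis ennreal_eq_0_iff ennreal_inj linear neg_0_le_iff_le neg_le_0_iff_le antisym)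
  have "AE \<omega> in ?N. F \<omega> = 0"
  proof (rule AE_restr_to_subalg2[OF sub F0])
    have "F \<in> borel_measurable (tail_algebra G l)"
      using TL[OF Lf] measurable_in_subalg'[OF sub] by (auto simp: Linf_def F_def)
    then show "Measurable.pred (tail_algebra G l) (\<lambda>\<omega>. F \<omega> = 0)" by simp
  qed
  moreover have zL: "(\<lambda>_. 0) \<in> Linf (fam B 0 0)" by (auto simp: Linf_def)
  moreover have "AE \<omega> in ?N. T (\<lambda>b. 0 * f b) \<omega> = 0 * T f \<omega>"
    using T Lf by (simp only: Linf_iso_def)
  ultimately have "AE \<omega> in ?N. T f \<omega> = T (\<lambda>_. 0) \<omega>"
    by (simp add: F_def) (auto elim: eventually_elim2)
  then show ?thesis using T_cong[OF Lf zL] by simp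
qed

end

section \<open>Standard Borel spaces\<close>

lemma second_countable_base:
  assumes "second_countable T"
  obtains \<B> where "countable \<B>" "\<And>V. V \<in> \<B> \<Longrightarrow> openin T V"
    "\<And>U x. openin T U \<Longrightarrow> x \<in> U \<Longrightarrow> \<exists>V\<in>\<B>. x \<in> V \<and> V \<subseteq> U"
proof -
  from assms obtain \<B> where B: "countable \<B> \<and> (\<forall>V\<in>\<B>. openin T V) \<and>
      (\<forall>U x. openin T U \<and> x \<in> U \<longrightarrow> (\<exists>V\<in>\<B>. x \<in> V \<and> V \<subseteq> U))"
    unfolding second_countable_def by (rule exE)
  show ?thesis
  proof (rule that)
    show "countable \<B>" using B by (rule conjunct1)
    show "openin T V" if "V \<in> \<B>" for V
      using B[THEN conjunct2, THEN conjunct1] that by (rule bspec)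
    show "\<exists>V\<in>\<B>. x \<in> V \<and> V \<subseteq> U" if "openin T U" "x \<in> U" for U x
      using B[THEN conjunct2, THEN conjunct2, rule_format, OF conjI[OF that]] .
  qed
qed

text \<open>The finite intersections of a countable base generate the Borel sets. The whole space is the empty
  intersection.\<close>

lemma standard_borel_generator:
  assumes "standard_borel M"
  obtains E where "countable E" "Int_stable E" "E \<subseteq> Pow (space M)" "space M \<in> E"
    "sets M = sigma_sets (space M) E"
proof -
  obtain T where T: "second_countable T" "topspace T = space M"
    "sets M = sigma_sets (space M) {U. openin T U}"
    using assms by (auto simp: standard_borel_def)
  obtain \<B> where \<B>: "countable \<B>" "\<And>V. V \<in> \<B> \<Longrightarrow> openin T V"
    "\<And>U x. openin T U \<Longrightarrow> x \<in> U \<Longrightarrow> \<exists>V\<in>\<B>. x \<in> V \<and> V \<subseteq> U"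
    using second_countable_base[OF T(1)] by metis
  define E where "E = (\<lambda>\<F>. space M \<inter> \<Inter>\<F>) ` {\<F>. finite \<F> \<and> \<F> \<subseteq> \<B>}"
  have "countable E"
    unfolding E_def using countable_Collect_finite_subset[OF \<B>(1)] by (rule countable_image)
  moreover have "Int_stable E"
  proof (rule Int_stableI)
    fix a b assume "a \<in> E" "b \<in> E"
    then obtain \<F> \<F>' where "a = space M \<inter> \<Inter>\<F>" "finite \<F>" "\<F> \<subseteq> \<B>"
      "b = space M \<inter> \<Inter>\<F>'" "finite \<F>'" "\<F>' \<subseteq> \<B>" by (auto simp: E_def)
    then show "a \<inter> b \<in> E" unfolding E_def by (intro image_eqI[of _ _ "\<F> \<union> \<F>'"]) auto
  qed
  moreover have E: "E \<subseteq> Pow (space M)" by (auto simp: E_def)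
  moreover have "space M \<in> E" unfolding E_def by (intro image_eqI[of _ _ "{}"]) auto
  moreover have "sets M = sigma_sets (space M) E"
  proof (intro antisym)
    interpret E: sigma_algebra "space M" "sigma_sets (space M) E"
      using E by (rule sigma_algebra_sigma_sets)
    have "U \<in> sigma_sets (space M) E" if U: "openin T U" for U
    proof -
      have "U = \<Union>{V \<in> \<B>. V \<subseteq> U}" using \<B>(3)[OF U] by auto
      moreover have "V \<in> sigma_sets (space M) E" if "V \<in> \<B>" for V
      proof -
        have "V = space M \<inter> \<Inter>{V}" using openin_subset[OF \<B>(2)[OF that]] T(2) by auto
        then have "V \<in> E" unfolding E_def using that by (intro image_eqI[of _ _ "{V}"]) auto
        then show ?thesis by (rule sigma_sets.Basic)
      qed
      ultimately show ?thesis
        using E.countable_Union[of "{V \<in> \<B>. V \<subseteq> U}"] \<B>(1) by auto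
    qed
    then show "sets M \<subseteq> sigma_sets (space M) E"
      unfolding T(3) by (intro E.sigma_sets_subset) auto
    have "space M \<inter> \<Inter>\<F> \<in> sets M" if "finite \<F>" "\<F> \<subseteq> \<B>" for \<F>
      using that
    proof (induction \<F>)
      case (insert V \<F>)
      have "V \<in> sets M" using insert \<B>(2) by (auto simp: T(3))
      moreover have "space M \<inter> \<Inter>(insert V \<F>) = V \<inter> (space M \<inter> \<Inter>\<F>)" by auto
      ultimately show ?case using insert by auto
    qed simp
    then have "E \<subseteq> sets M" unfolding E_def by blast
    then show "sigma_sets (space M) E \<subseteq> sets M" by (rule sets.sigma_sets_subset)
  qed
  ultimately show ?thesis by (rule that)
qed

lemma standard_borel_pair:
  assumes "standard_borel M" "standard_borel N"
  shows "standard_borel (M \<Otimes>\<^sub>M N)"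
proof -
  obtain S where S: "completely_metrizable_space S" "second_countable S" "topspace S = space M"
    "sets M = sigma_sets (space M) {U. openin S U}"
    using assms(1) by (auto simp: standard_borel_def)
  obtain T where T: "completely_metrizable_space T" "second_countable T" "topspace T = space N"
    "sets N = sigma_sets (space N) {U. openin T U}"
    using assms(2) by (auto simp: standard_borel_def)
  obtain \<A> where \<A>: "countable \<A>" "\<And>V. V \<in> \<A> \<Longrightarrow> openin S V"
    "\<And>U x. openin S U \<Longrightarrow> x \<in> U \<Longrightarrow> \<exists>V\<in>\<A>. x \<in> V \<and> V \<subseteq> U"
    using second_countable_base[OF S(2)] by metis
  obtain \<B> where \<B>: "countable \<B>" "\<And>V. V \<in> \<B> \<Longrightarrow> openin T V"
    "\<And>U x. openin T U \<Longrightarrow> x \<in> U \<Longrightarrow> \<exists>V\<in>\<B>. x \<in> V \<and> V \<subseteq> U"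
    using second_countable_base[OF T(2)] by metis
  let ?P = "prod_topology S T"
  \<comment> \<open>The products of basic open sets are a countable base of the product topology, so open sets are
     countable unions of measurable rectangles.\<close>
  let ?R = "(\<lambda>(V, W). V \<times> W) ` (\<A> \<times> \<B>)"
  have R: "countable ?R" using \<A>(1) \<B>(1) by (intro countable_image countable_SIGMA)
  have R_open: "openin ?P V" if "V \<in> ?R" for V
    using that \<A>(2) \<B>(2) by (auto simp: openin_prod_Times_iff)
  have R_base: "\<exists>V\<in>?R. x \<in> V \<and> V \<subseteq> U" if U: "openin ?P U" "x \<in> U" for U x
  proof -
    obtain a b where x: "x = (a, b)" by (cases x)
    obtain V W where "openin S V" "openin T W" "a \<in> V" "b \<in> W" "V \<times> W \<subseteq> U"
      using U(1)[unfolded openin_prod_topology_alt, rule_format, of a b] U(2) by (auto simp: x)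
    moreover obtain V' where "V' \<in> \<A>" "a \<in> V'" "V' \<subseteq> V"
      using \<A>(3)[OF \<open>openin S V\<close> \<open>a \<in> V\<close>] by auto
    moreover obtain W' where "W' \<in> \<B>" "b \<in> W'" "W' \<subseteq> W"
      using \<B>(3)[OF \<open>openin T W\<close> \<open>b \<in> W\<close>] by auto
    ultimately show ?thesis unfolding x by (intro bexI[of _ "V' \<times> W'"]) auto
  qed
  have sec: "second_countable ?P"
    unfolding second_countable_def
  proof (intro exI[of _ ?R] conjI ballI allI impI)
    show "\<exists>V\<in>?R. x \<in> V \<and> V \<subseteq> U" if "openin ?P U \<and> x \<in> U" for U x
      using that by (intro R_base) auto
  qed (fact R, rule R_open)
  have openS: "U \<in> sets M" if "openin S U" for U using that by (auto simp: S(4))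
  have openT: "U \<in> sets N" if "openin T U" for U using that by (auto simp: T(4))
  have "sets (M \<Otimes>\<^sub>M N) = sigma_sets (space (M \<Otimes>\<^sub>M N)) {U. openin ?P U}"
  proof (intro antisym)
    have "U \<in> sets (M \<Otimes>\<^sub>M N)" if U: "openin ?P U" for U
    proof -
      have "U = \<Union>{V \<in> ?R. V \<subseteq> U}"
      proof (intro antisym subsetI)
        fix x assume x: "x \<in> U"
        obtain V where "V \<in> ?R" "x \<in> V" "V \<subseteq> U" using R_base[OF U x] by (elim bexE conjE)
        then show "x \<in> \<Union>{V \<in> ?R. V \<subseteq> U}" by (intro UnionI[of V]) simp_all
      qed auto
      moreover have "V \<in> sets (M \<Otimes>\<^sub>M N)" if "V \<in> ?R" for V
      proof -
        from that obtain A' B' where "V = A' \<times> B'" "A' \<in> \<A>" "B' \<in> \<B>" by auto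
        then show ?thesis using openS[OF \<A>(2)] openT[OF \<B>(2)] by simp
      qed
      moreover have "countable {V \<in> ?R. V \<subseteq> U}" using R by simp
      ultimately show ?thesis
        by (metis (no_types, lifting) mem_Collect_eq sets.countable_Union subsetI)
    qed
    then show "sigma_sets (space (M \<Otimes>\<^sub>M N)) {U. openin ?P U} \<subseteq> sets (M \<Otimes>\<^sub>M N)"
      by (intro sets.sigma_sets_subset) auto
    let ?Q = "sigma (space M \<times> space N) {U. openin ?P U}"
    have sub: "{U. openin ?P U} \<subseteq> Pow (space M \<times> space N)"
      using openin_subset[of ?P] S(3) T(3) by auto
    have sets_Q: "sets ?Q = sigma_sets (space M \<times> space N) {U. openin ?P U}"
      using sub by (rule sets_measure_of)
    have space_Q: "space ?Q = space M \<times> space N" using sub by (rule space_measure_of)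
    have "fst \<in> measurable ?Q M"
    proof (rule measurable_sigma_sets[OF S(4)])
      fix U assume "U \<in> {U. openin S U}"
      then have "openin ?P (U \<times> topspace T)" by (auto simp: openin_prod_Times_iff)
      moreover have "fst -` U \<inter> space ?Q = U \<times> topspace T"
        using \<open>U \<in> _\<close> openin_subset[of S U] S(3) T(3) by (auto simp: space_Q)
      ultimately show "fst -` U \<inter> space ?Q \<in> sets ?Q" by (simp add: sets_Q)
    qed (use openin_subset[of S] S(3) in \<open>auto simp: space_Q\<close>)
    moreover have "snd \<in> measurable ?Q N"
    proof (rule measurable_sigma_sets[OF T(4)])
      fix U assume "U \<in> {U. openin T U}"
      then have "openin ?P (topspace S \<times> U)" by (auto simp: openin_prod_Times_iff)
      moreover have "snd -` U \<inter> space ?Q = topspace S \<times> U"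
        using \<open>U \<in> _\<close> openin_subset[of T U] S(3) T(3) by (auto simp: space_Q)
      ultimately show "snd -` U \<inter> space ?Q \<in> sets ?Q" by (simp add: sets_Q)
    qed (use openin_subset[of T] T(3) in \<open>auto simp: space_Q\<close>)
    ultimately have "(\<lambda>x. x) \<in> measurable ?Q (M \<Otimes>\<^sub>M N)"
      by (simp add: measurable_pair_iff comp_def)
    note id = this
    have "A \<in> sets ?Q" if "A \<in> sets (M \<Otimes>\<^sub>M N)" for A
    proof -
      have "A \<subseteq> space ?Q"
        using sets.sets_into_space[OF that] by (simp only: space_Q space_pair_measure)
      then show ?thesis
        using measurable_sets[OF id that] by (simp only: vimage_ident Int_absorb2)
    qed
    then show "sets (M \<Otimes>\<^sub>M N) \<subseteq> sigma_sets (space (M \<Otimes>\<^sub>M N)) {U. openin ?P U}"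
      by (simp only: sets_Q space_pair_measure subset_eq) simp
  qed
  then show ?thesis
    unfolding standard_borel_def using sec S(1,3) T(1,3)
    by (intro exI[of _ ?P] conjI)
       (simp_all only: completely_metrizable_space_prod_topology space_pair_measure topspace_prod_topology simp_thms)
qed

section \<open>Uniqueness of conditional measures and proximal systems\<close>

lemma conditional_measuresD:
  assumes "conditional_measures G l B X \<Phi>"
  shows "\<Phi> \<in> measurable (alg B) (prob_algebra (alg X))"
    and "g \<in> carrier G \<Longrightarrow> AE b in fam B 0 0. \<Phi> (act B g b) = translate X g (\<Phi> b)"
    and "j < dim_at l k \<Longrightarrow> g \<in> carrier G \<Longrightarrow>
      translate X g (fam X k j) = Giry_Monad.bind (translate B g (fam B k j)) \<Phi>"
    and "b \<in> space (alg B) \<Longrightarrow> prob_space (\<Phi> b)"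
    and "b \<in> space (alg B) \<Longrightarrow> sets (\<Phi> b) = sets (alg X)"
    and "b \<in> space (alg B) \<Longrightarrow> space (\<Phi> b) = space (alg X)"
proof -
  show M: "\<Phi> \<in> measurable (alg B) (prob_algebra (alg X))"
    using assms by (simp add: conditional_measures_def G_map_def)
  show "g \<in> carrier G \<Longrightarrow> AE b in fam B 0 0. \<Phi> (act B g b) = translate X g (\<Phi> b)"
    using assms by (simp add: conditional_measures_def G_map_def)
  show "j < dim_at l k \<Longrightarrow> g \<in> carrier G \<Longrightarrow>
      translate X g (fam X k j) = Giry_Monad.bind (translate B g (fam B k j)) \<Phi>"
    using assms by (simp add: conditional_measures_def)
  show "prob_space (\<Phi> b)" "sets (\<Phi> b) = sets (alg X)" "space (\<Phi> b) = space (alg X)" if "b \<in> space (alg B)"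
    using measurable_space[OF M that] by (auto simp: space_prob_algebra dest: sets_eq_imp_space_eq)
qed

context stochastic_walk begin

lemma translate_in_prob_algebra:
  assumes "sigma_system G l \<sigma> X" "j < dim_at l k" "g \<in> carrier G"
  shows "translate X g (fam X k j) \<in> space (prob_algebra (alg X))"
  using act_measurable_fam[OF assms] sigma_systemD(2)[OF assms(1,2)]
  by (simp add: space_prob_algebra prob_space.prob_space_distr)

text \<open>A kernel from the boundary to a standard Borel space is determined almost everywhere by its
  barycenters. It suffices to compare the measures of countably many sets, and for one set the
  difference of the two measures is a bounded function on the boundary with vanishing integrals.\<close>

lemma kernel_unique:
  assumes B: "poisson_boundary G l \<sigma> B" and M: "standard_borel M"
    and \<Phi>: "\<Phi> \<in> measurable (alg B) (prob_algebra M)" and \<Psi>: "\<Psi> \<in> measurable (alg B) (prob_algebra M)"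
    and eq: "\<And>k j g. j < dim_at l k \<Longrightarrow> g \<in> carrier G \<Longrightarrow>
      Giry_Monad.bind (translate B g (fam B k j)) \<Phi> = Giry_Monad.bind (translate B g (fam B k j)) \<Psi>"
  shows "AE b in fam B 0 0. \<Phi> b = \<Psi> b"
proof -
  have d0: "0 < dim_at l 0" by (simp add: dim_at_def)
  have X: "sigma_system G l \<sigma> B"
    using B by (simp add: poisson_boundary_def regular_system_def)
  obtain E where E: "countable E" "Int_stable E" "E \<subseteq> Pow (space M)" "space M \<in> E"
    "sets M = sigma_sets (space M) E"
    using M by (rule standard_borel_generator)
  have prob: "prob_space (K b)" "sets (K b) = sets M"
    if "b \<in> space (alg B)" "K \<in> measurable (alg B) (prob_algebra M)" for K b
    using measurable_space[OF that(2,1)] by (auto simp: space_prob_algebra)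
  have "AE b in fam B 0 0. measure (\<Phi> b) A = measure (\<Psi> b) A" if "A \<in> E" for A
  proof -
    have A: "A \<in> sets M" using that by (simp add: E(5))
    have m: "(\<lambda>b. measure (K b) A) \<in> borel_measurable (alg B)"
      if "K \<in> measurable (alg B) (prob_algebra M)" for K
      using that A by measurable
    have bounded: "\<bar>measure (\<Phi> b) A - measure (\<Psi> b) A\<bar> \<le> 1" if "b \<in> space (alg B)" for b
      using prob_space.prob_le_1[OF prob(1)[OF that \<Phi>], of A] prob_space.prob_le_1[OF prob(1)[OF that \<Psi>], of A]
        measure_nonneg[of "\<Phi> b" A] measure_nonneg[of "\<Psi> b" A] by linarith
    have zero: "(\<integral>b. measure (\<Phi> (act B g b)) A - measure (\<Psi> (act B g b)) A \<partial>fam B k j) = 0"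
      if j: "j < dim_at l k" and g: "g \<in> carrier G" for k j g
    proof -
      let ?T = "translate B g (fam B k j)"
      interpret T: prob_space ?T
        using translate_in_prob_algebra[OF X j g] by (simp add: space_prob_algebra)
      have int: "(\<integral>b. measure (K b) A \<partial>?T) = measure (Giry_Monad.bind ?T K) A" "integrable ?T (\<lambda>b. measure (K b) A)"
        if K: "K \<in> measurable (alg B) (prob_algebra M)" for K
      proof -
        have "K \<in> measurable ?T (subprob_algebra M)"
          using measurable_prob_algebraD[OF K] by (simp cong: measurable_cong_sets)
        then show "(\<integral>b. measure (K b) A \<partial>?T) = measure (Giry_Monad.bind ?T K) A"
          using A by (rule T.measure_bind[symmetric])
        show "integrable ?T (\<lambda>b. measure (K b) A)"
          using m[OF K] prob(1)[OF _ K]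
          by (intro T.integrable_const_bound[of _ 1])
             (auto intro!: AE_I2 prob_space.prob_le_1 cong: measurable_cong_sets)
      qed
      have "(\<integral>b. measure (\<Phi> (act B g b)) A - measure (\<Psi> (act B g b)) A \<partial>fam B k j) =
          (\<integral>b. measure (\<Phi> b) A - measure (\<Psi> b) A \<partial>?T)"
        using m[OF \<Phi>] m[OF \<Psi>] by (intro integral_distr[OF act_measurable_fam[OF X j g], symmetric]) simp
      also have "\<dots> = 0"
        using int[OF \<Phi>] int[OF \<Psi>] eq[OF j g] by simp
      finally show ?thesis .
    qed
    have "AE b in fam B 0 0. measure (\<Phi> b) A - measure (\<Psi> b) A = 0"
      using m[OF \<Phi>] m[OF \<Psi>] by (intro boundary_function_zero[OF B _ bounded zero]) auto
    then show ?thesis by simp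
  qed
  then have "AE b in fam B 0 0. \<forall>A\<in>E. measure (\<Phi> b) A = measure (\<Psi> b) A"
    using E(1) by (simp add: AE_ball_countable)
  moreover have "AE b in fam B 0 0. b \<in> space (alg B)"
    using sigma_systemD(4)[OF X d0] by (auto intro: AE_I2)
  ultimately show ?thesis
  proof eventually_elim
    case (elim b)
    interpret P: prob_space "\<Phi> b" using prob(1)[OF elim(2) \<Phi>] .
    interpret Q: prob_space "\<Psi> b" using prob(1)[OF elim(2) \<Psi>] .
    show "\<Phi> b = \<Psi> b"
      using prob(2)[OF elim(2) \<Phi>] prob(2)[OF elim(2) \<Psi>] elim(1) E(4)
      by (intro measure_eqI_generator_eq[OF E(2,3), where A = "\<lambda>_. space M"])
         (auto simp: E(5) P.emeasure_eq_measure Q.emeasure_eq_measure)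
  qed
qed

lemma conditional_measures_unique:
  assumes "poisson_boundary G l \<sigma> B" "standard_borel (alg X)"
    and "conditional_measures G l B X \<Phi>" "conditional_measures G l B X \<Psi>"
  shows "AE b in fam B 0 0. \<Phi> b = \<Psi> b"
  using conditional_measuresD(3)[OF assms(3)] conditional_measuresD(3)[OF assms(4)]
  by (intro kernel_unique[OF assms(1,2) conditional_measuresD(1)[OF assms(3)] conditional_measuresD(1)[OF assms(4)]])
     metis

lemma conditional_measures_bind:
  assumes B: "sigma_system G l \<sigma> B" and X: "sigma_system G l \<sigma> X"
    and \<Phi>: "conditional_measures G l B X \<Phi>" and j: "j < dim_at l k"
  shows "fam X k j = Giry_Monad.bind (fam B k j) \<Phi>"
  using conditional_measuresD(3)[OF \<Phi> j one_closed] translate_one[OF B j] translate_one[OF X j]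
  by simp

end

text \<open>An isomorphism modulo null sets from a probability measure to a point forces a point mass, and its
  atom is a measurable set.\<close>

lemma AE_proximal_return:
  assumes prox: "proximal_system G l \<sigma> B Y" and \<Psi>: "conditional_measures G l B Y \<Psi>"
    and B: "sigma_system G l \<sigma> B"
  shows "AE b in fam B 0 0. \<exists>y\<in>space (alg Y). {y} \<in> sets (alg Y) \<and> \<Psi> b = return (alg Y) y"
proof -
  obtain \<Theta> where "AE b in fam B 0 0. iso_mod_null (\<Psi> b) (\<Theta> b) (\<lambda>_. ())"
    using prox \<Psi> unfolding proximal_system_def proximal_extension_def by blast
  moreover have "AE b in fam B 0 0. b \<in> space (alg B)"
    using sigma_systemD(4)[OF B, of 0 0] by (auto intro: AE_I2 simp: dim_at_def)
  ultimately show ?thesis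
  proof eventually_elim
    case (elim b)
    interpret P: prob_space "\<Psi> b" using conditional_measuresD(4)[OF \<Psi> elim(2)] .
    note P_sets = conditional_measuresD(5,6)[OF \<Psi> elim(2)]
    obtain A C where A: "A \<in> sets (\<Psi> b)" "space (\<Psi> b) - A \<in> null_sets (\<Psi> b)" "bij_betw (\<lambda>_. ()) A C"
      using elim(1) unfolding iso_mod_null_def by blast
    have "AE x in \<Psi> b. x \<in> A"
      using A(2) by (intro AE_I'[OF A(2)]) auto
    moreover have "A \<noteq> {}"
      using calculation P.AE_False by auto
    moreover have "inj_on (\<lambda>_. ()) A" using A(3) by (rule bij_betw_imp_inj_on)
    ultimately obtain y where y: "A = {y}"
      by (auto simp: inj_on_def)
    then have "AE x in \<Psi> b. x = y" using \<open>AE x in \<Psi> b. x \<in> A\<close> by simp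
    then have "\<Psi> b = return (\<Psi> b) y" "y \<in> space (\<Psi> b)" by (rule P.AE_eq_constD)+
    then show ?case
      using A(1) y P_sets return_sets_cong[OF P_sets(1)] by auto
  qed
qed

lemma iso_mod_null_pair_return:
  assumes M: "prob_space M" and y: "y \<in> space N" "{y} \<in> sets N"
  shows "iso_mod_null (M \<Otimes>\<^sub>M return N y) M fst"
proof -
  interpret R: prob_space "return N y" using y(1) by (rule prob_space_return)
  interpret M: prob_space M by fact
  let ?P = "M \<Otimes>\<^sub>M return N y" and ?A = "space M \<times> {y}"
  have A: "?A \<in> sets ?P" using y by auto
  have "space ?P - ?A = space M \<times> (space N - {y})"
    by (auto simp: space_pair_measure)
  then have "emeasure ?P (space ?P - ?A) = 0"
    using y by (simp add: R.emeasure_pair_measure_Times)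
  then have null: "space ?P - ?A \<in> null_sets ?P"
    using A sets.compl_sets[OF A] by (simp only: null_setsI)
  have inv: "the_inv_into ?A fst x = (x, y)" if "x \<in> space M" for x
    using that by (intro the_inv_into_f_eq) (auto simp: inj_on_def)
  have "(\<lambda>x. (x, y)) \<in> measurable (restrict_space M (space M)) (restrict_space ?P ?A)"
    using y by (intro measurable_restrict_space2) (auto simp: space_restrict_space intro!: measurable_restrict_space1)
  then have m: "the_inv_into ?A fst \<in> measurable (restrict_space M (space M)) (restrict_space ?P ?A)"
    using inv by (subst measurable_cong[where g = "\<lambda>x. (x, y)"]) (auto simp: space_restrict_space)
  have bij: "bij_betw fst ?A (space M)" by (auto simp: bij_betw_def inj_on_def)
  have "fst \<in> measurable (restrict_space ?P ?A) (restrict_space M (space M))"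
    by (intro measurable_restrict_space3) auto
  then show ?thesis
    unfolding iso_mod_null_def using A null m bij R.distr_pair_fst[of M]
    by (intro conjI bexI[of _ ?A] bexI[of _ "space M"]) auto
qed

section \<open>The joining\<close>

text \<open>Two systems with conditional measures \<open>\<Phi>\<close> and \<open>\<Psi>\<close>. In the application \<open>Y\<close> is the proximal system.\<close>

locale joined_systems = stochastic_walk G l \<sigma> for G :: "('g, 'r) monoid_scheme" (structure) and l \<sigma> +
  fixes B :: "('g, 'b) gsystem" and X :: "('g, 'x) gsystem" and Y :: "('g, 'y) gsystem"
    and \<Phi> :: "'b \<Rightarrow> 'x measure" and \<Psi> :: "'b \<Rightarrow> 'y measure"
  assumes B: "sigma_system G l \<sigma> B" and X: "sigma_system G l \<sigma> X" and Y: "sigma_system G l \<sigma> Y"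
    and \<Phi>: "conditional_measures G l B X \<Phi>" and \<Psi>: "conditional_measures G l B Y \<Psi>"
begin

abbreviation J :: "('g, 'x \<times> 'y) gsystem" where "J \<equiv> joining B X \<Phi> Y \<Psi>"

abbreviation \<Theta> :: "'b \<Rightarrow> ('x \<times> 'y) measure" where "\<Theta> \<equiv> \<lambda>b. \<Phi> b \<Otimes>\<^sub>M \<Psi> b"

lemma joining_sel [simp]:
  "alg J = alg X \<Otimes>\<^sub>M alg Y" "act J g = map_prod (act X g) (act Y g)"
  "fam J k j = Giry_Monad.bind (fam B k j) \<Theta>"
  by (simp_all add: joining_def)

lemma \<Theta>_measurable: "\<Theta> \<in> measurable (alg B) (prob_algebra (alg X \<Otimes>\<^sub>M alg Y))"
  using conditional_measuresD(1)[OF \<Phi>] conditional_measuresD(1)[OF \<Psi>] by (rule measurable_pair_prob)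

lemma joining_act_measurable:
  assumes "g \<in> carrier G"
  shows "act J g \<in> measurable (alg J) (alg J)"
proof -
  note [measurable] = measurable_actionD(1)[OF sigma_systemD(1)[OF X] assms]
    measurable_actionD(1)[OF sigma_systemD(1)[OF Y] assms]
  have "(\<lambda>z. (act X g (fst z), act Y g (snd z))) \<in> measurable (alg X \<Otimes>\<^sub>M alg Y) (alg X \<Otimes>\<^sub>M alg Y)"
    by measurable
  then show ?thesis by (simp add: map_prod_def case_prod_beta')
qed

lemma joining_action: "measurable_action G (alg J) (act J)"
proof (rule measurable_actionI)
  show "act J \<one> z = z" if "z \<in> space (alg J)" for z
    using that measurable_actionD(2)[OF sigma_systemD(1)[OF X]] measurable_actionD(2)[OF sigma_systemD(1)[OF Y]]
    by (auto simp: space_pair_measure)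
  show "act J (g \<otimes> h) z = act J g (act J h z)"
    if "g \<in> carrier G" "h \<in> carrier G" "z \<in> space (alg J)" for g h z
    using that measurable_actionD(3)[OF sigma_systemD(1)[OF X]] measurable_actionD(3)[OF sigma_systemD(1)[OF Y]]
    by (auto simp: space_pair_measure)
qed (rule joining_act_measurable)

lemma joining_fam:
  assumes "j < dim_at l k"
  shows "fam J k j \<in> space (prob_algebra (alg J))"
  using prob_space_bind'[OF sigma_systemD(5)[OF B assms] \<Theta>_measurable]
    sets_bind'[OF sigma_systemD(5)[OF B assms] \<Theta>_measurable]
  by (simp add: space_prob_algebra)

lemma \<Theta>_equivariant:
  assumes g: "g \<in> carrier G"
  shows "AE b in fam B 0 0. \<Theta> (act B g b) = translate J g (\<Theta> b)"
proof -
  have "AE b in fam B 0 0. b \<in> space (alg B)"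
    using sigma_systemD(4)[OF B, of 0 0] by (auto intro: AE_I2 simp: dim_at_def)
  with conditional_measuresD(2)[OF \<Phi> g] conditional_measuresD(2)[OF \<Psi> g] show ?thesis
  proof eventually_elim
    case (elim b)
    have mX: "act X g \<in> measurable (\<Phi> b) (alg X)" and mY: "act Y g \<in> measurable (\<Psi> b) (alg Y)"
      using measurable_actionD(1)[OF sigma_systemD(1)[OF X] g] measurable_actionD(1)[OF sigma_systemD(1)[OF Y] g]
        conditional_measuresD(5)[OF \<Phi> elim(3)] conditional_measuresD(5)[OF \<Psi> elim(3)]
      by (simp_all cong: measurable_cong_sets)
    have "prob_space (distr (\<Psi> b) (alg Y) (act Y g))"
      using conditional_measuresD(4)[OF \<Psi> elim(3)] mY by (rule prob_space.prob_space_distr)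
    then have "distr (\<Phi> b) (alg X) (act X g) \<Otimes>\<^sub>M distr (\<Psi> b) (alg Y) (act Y g) =
        distr (\<Phi> b \<Otimes>\<^sub>M \<Psi> b) (alg X \<Otimes>\<^sub>M alg Y) (\<lambda>(x, y). (act X g x, act Y g y))"
      by (intro pair_measure_distr mX mY prob_space_imp_sigma_finite)
    then show ?case
      using elim(1,2) by (simp add: map_prod_def)
  qed
qed

text \<open>By equivariance of the kernel, translating a measure of the joining amounts to translating the
  measure on the boundary that is integrated. This contains both the stationarity of the joining and the
  fact that \<open>\<Theta>\<close> is its family of conditional measures.\<close>

lemma translate_joining:
  assumes j: "j < dim_at l k" and g: "g \<in> carrier G"
  shows "translate J g (fam J k j) = Giry_Monad.bind (translate B g (fam B k j)) \<Theta>"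
proof -
  let ?m = "fam B k j"
  have ne: "space ?m \<noteq> {}" using prob_space.not_empty[OF sigma_systemD(2)[OF B j]] .
  have \<Theta>m: "\<Theta> \<in> measurable ?m (subprob_algebra (alg J))"
    using measurable_prob_algebraD[OF \<Theta>_measurable] sigma_systemD(3)[OF B j]
    by (simp cong: measurable_cong_sets)
  have "translate J g (fam J k j) = Giry_Monad.bind ?m (\<lambda>b. translate J g (\<Theta> b))"
    using distr_bind[OF \<Theta>m ne joining_act_measurable[OF g]] by simp
  also have "\<dots> = Giry_Monad.bind ?m (\<lambda>b. \<Theta> (act B g b))"
  proof (rule bind_cong_AE'[OF sigma_systemD(5)[OF B j]])
    show "(\<lambda>b. translate J g (\<Theta> b)) \<in> measurable (alg B) (prob_algebra (alg J))"
      using \<Theta>_measurable joining_act_measurable[OF g]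
      by (intro measurable_compose[OF _ measurable_distr_prob_space, of \<Theta>]) simp_all
    show "(\<lambda>b. \<Theta> (act B g b)) \<in> measurable (alg B) (prob_algebra (alg J))"
      using measurable_compose[OF measurable_actionD(1)[OF sigma_systemD(1)[OF B] g] \<Theta>_measurable] by simp
    show "AE b in ?m. translate J g (\<Theta> b) = \<Theta> (act B g b)"
      using AE_fam[OF B \<Theta>_equivariant[OF g] j] by eventually_elim (rule sym)
  qed
  also have "\<dots> = Giry_Monad.bind (translate B g ?m) \<Theta>"
    using bind_distr[OF act_measurable_fam[OF B j g] measurable_prob_algebraD[OF \<Theta>_measurable] ne] by simp
  finally show ?thesis .
qed

lemma joining_sigma_system: "sigma_system G l \<sigma> J"
proof -
  have "emeasure (fam J n i) A = (\<Sum>j<l n. conv_emeasure G J (\<sigma> n i j) (fam J (Suc n) j) A)"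
    if i: "i < dim_at l n" and A: "A \<in> sets (alg J)" for n i A
  proof -
    have m: "(\<lambda>b. emeasure (\<Theta> b) A) \<in> borel_measurable (alg B)"
      using measurable_compose[OF measurable_prob_algebraD[OF \<Theta>_measurable] measurable_emeasure_subprob_algebra] A
      by simp
    have "emeasure (fam J n i) A = (\<integral>\<^sup>+b. emeasure (\<Theta> b) A \<partial>fam B n i)"
      using emeasure_bind_prob_algebra[OF sigma_systemD(5)[OF B i] \<Theta>_measurable] A by simp
    also have "\<dots> = (\<Sum>j<l n. \<integral>\<^sup>+g. emeasure (\<sigma> n i j) {g} *
        (\<integral>\<^sup>+b. emeasure (\<Theta> (act B g b)) A \<partial>fam B (Suc n) j) \<partial>count_space (carrier G))"
      by (rule sigma_system_nn_integral[OF B i m])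
    also have "\<dots> = (\<Sum>j<l n. conv_emeasure G J (\<sigma> n i j) (fam J (Suc n) j) A)"
      unfolding conv_emeasure_def
    proof (intro sum.cong refl nn_integral_cong arg_cong2[where f = "(*)"])
      fix j g assume "j \<in> {..<l n}" "g \<in> space (count_space (carrier G))"
      then have j: "j < dim_at l (Suc n)" and g: "g \<in> carrier G" by (auto simp: dim_at_def)
      have "(\<integral>\<^sup>+b. emeasure (\<Theta> (act B g b)) A \<partial>fam B (Suc n) j) =
          (\<integral>\<^sup>+b. emeasure (\<Theta> b) A \<partial>translate B g (fam B (Suc n) j))"
        using m by (intro nn_integral_distr[OF act_measurable_fam[OF B j g], symmetric]) simp
      also have "\<dots> = emeasure (translate J g (fam J (Suc n) j)) A"
        unfolding translate_joining[OF j g]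
        using emeasure_bind_prob_algebra[OF translate_in_prob_algebra[OF B j g] \<Theta>_measurable] A by simp
      finally show "(\<integral>\<^sup>+b. emeasure (\<Theta> (act B g b)) A \<partial>fam B (Suc n) j) =
          emeasure (translate J g (fam J (Suc n) j)) A" .
    qed
    finally show ?thesis .
  qed
  then show ?thesis
    unfolding sigma_system_def using joining_action joining_fam by (simp only: space_prob_algebra) blast
qed

lemma joining_conditional_measures: "conditional_measures G l B J \<Theta>"
  unfolding conditional_measures_def G_map_def
  using \<Theta>_measurable \<Theta>_equivariant translate_joining by simp

lemma fst_factor: "factor_map G l J X fst"
  unfolding factor_map_def G_map_def
proof (intro conjI ballI allI impI)
  fix k j assume j: "j < dim_at l k"
  have ne: "space (fam B k j) \<noteq> {}" using prob_space.not_empty[OF sigma_systemD(2)[OF B j]] .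
  have \<Theta>m: "\<Theta> \<in> measurable (fam B k j) (subprob_algebra (alg J))"
    using measurable_prob_algebraD[OF \<Theta>_measurable] sigma_systemD(3)[OF B j]
    by (simp cong: measurable_cong_sets)
  have "distr (fam J k j) (alg X) fst = Giry_Monad.bind (fam B k j) (\<lambda>b. distr (\<Theta> b) (alg X) fst)"
    using distr_bind[OF \<Theta>m ne, of fst "alg X"] by simp
  also have "\<dots> = Giry_Monad.bind (fam B k j) \<Phi>"
  proof (intro bind_cong refl)
    fix b assume "b \<in> space (fam B k j)"
    then have b: "b \<in> space (alg B)" using sigma_systemD(4)[OF B j] by simp
    interpret P: prob_space "\<Psi> b" using conditional_measuresD(4)[OF \<Psi> b] .
    have "distr (\<Theta> b) (alg X) fst = distr (\<Theta> b) (\<Phi> b) fst"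
      using conditional_measuresD(5)[OF \<Phi> b] by (intro distr_cong) auto
    then show "distr (\<Theta> b) (alg X) fst = \<Phi> b" by (simp add: P.distr_pair_fst)
  qed
  also have "\<dots> = fam X k j" using conditional_measures_bind[OF B X \<Phi> j] by simp
  finally show "distr (fam J k j) (alg X) fst = fam X k j" .
qed (simp_all add: case_prod_beta' map_prod_def)

lemma snd_factor: "factor_map G l J Y snd"
  unfolding factor_map_def G_map_def
proof (intro conjI ballI allI impI)
  fix k j assume j: "j < dim_at l k"
  have ne: "space (fam B k j) \<noteq> {}" using prob_space.not_empty[OF sigma_systemD(2)[OF B j]] .
  have \<Theta>m: "\<Theta> \<in> measurable (fam B k j) (subprob_algebra (alg J))"
    using measurable_prob_algebraD[OF \<Theta>_measurable] sigma_systemD(3)[OF B j]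
    by (simp cong: measurable_cong_sets)
  have "distr (fam J k j) (alg Y) snd = Giry_Monad.bind (fam B k j) (\<lambda>b. distr (\<Theta> b) (alg Y) snd)"
    using distr_bind[OF \<Theta>m ne, of snd "alg Y"] by simp
  also have "\<dots> = Giry_Monad.bind (fam B k j) \<Psi>"
  proof (intro bind_cong refl)
    fix b assume "b \<in> space (fam B k j)"
    then have b: "b \<in> space (alg B)" using sigma_systemD(4)[OF B j] by simp
    interpret P: prob_space "\<Phi> b" using conditional_measuresD(4)[OF \<Phi> b] .
    interpret Q: prob_space "\<Psi> b" using conditional_measuresD(4)[OF \<Psi> b] .
    interpret PQ: pair_prob_space "\<Phi> b" "\<Psi> b" ..
    have "distr (\<Theta> b) (alg Y) snd = distr (\<Theta> b) (\<Psi> b) snd"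
      using conditional_measuresD(5)[OF \<Psi> b] by (intro distr_cong) auto
    also have "\<dots> = \<Psi> b"
    proof (rule measure_eqI)
      fix A assume "A \<in> sets (distr (\<Theta> b) (\<Psi> b) snd)"
      then have A: "A \<in> sets (\<Psi> b)" by simp
      have "snd -` A \<inter> space (\<Theta> b) = space (\<Phi> b) \<times> A"
        using sets.sets_into_space[OF A] by (auto simp: space_pair_measure)
      then show "emeasure (distr (\<Theta> b) (\<Psi> b) snd) A = emeasure (\<Psi> b) A"
        using A by (simp add: emeasure_distr Q.emeasure_pair_measure_Times P.emeasure_space_1)
    qed simp
    finally show "distr (\<Theta> b) (alg Y) snd = \<Psi> b" .
  qed
  also have "\<dots> = fam Y k j" using conditional_measures_bind[OF B Y \<Psi> j] by simp
  finally show "distr (fam J k j) (alg Y) snd = fam Y k j" .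
qed (simp_all add: case_prod_beta' map_prod_def)

end

section \<open>The two projections of the joining\<close>

lemma nn_integral_pair_return:
  assumes M: "prob_space M" and y: "y \<in> space N" and f: "f \<in> borel_measurable (M \<Otimes>\<^sub>M N)"
  shows "(\<integral>\<^sup>+z. f z \<partial>(M \<Otimes>\<^sub>M return N y)) = (\<integral>\<^sup>+x. f (x, y) \<partial>M)"
proof -
  interpret R: prob_space "return N y" using y by (rule prob_space_return)
  have "(\<integral>\<^sup>+z. f z \<partial>(M \<Otimes>\<^sub>M return N y)) = (\<integral>\<^sup>+x. \<integral>\<^sup>+y'. f (x, y') \<partial>return N y \<partial>M)"
    using f by (intro R.nn_integral_fst[symmetric]) (simp cong: measurable_cong_sets)
  also have "\<dots> = (\<integral>\<^sup>+x. f (x, y) \<partial>M)"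
    using f y by (intro nn_integral_cong nn_integral_return) (auto intro: measurable_compose[OF measurable_Pair1'])
  finally show ?thesis .
qed

context joined_systems begin

lemma fst_proximal:
  assumes PB: "poisson_boundary G l \<sigma> B" and sX: "standard_borel (alg X)" and sY: "standard_borel (alg Y)"
    and prox: "proximal_system G l \<sigma> B Y"
  shows "proximal_extension G l \<sigma> B J X fst"
  unfolding proximal_extension_def
proof (intro conjI allI impI)
  have sJ: "standard_borel (alg J)" using standard_borel_pair[OF sX sY] by simp
  show "regular_system G l \<sigma> J" "regular_system G l \<sigma> X"
    using joining_sigma_system X sJ sX by (simp_all add: regular_system_def)
  show "factor_map G l J X fst" by (rule fst_factor)
  show "\<exists>\<Phi>. conditional_measures G l B J \<Phi>" using joining_conditional_measures by blast
  show "\<exists>\<Psi>. conditional_measures G l B X \<Psi>" using \<Phi> by blast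
  fix \<Theta>' \<Phi>' assume \<Theta>': "conditional_measures G l B J \<Theta>'" and \<Phi>': "conditional_measures G l B X \<Phi>'"
  have "AE b in fam B 0 0. b \<in> space (alg B)"
    using sigma_systemD(4)[OF B, of 0 0] by (auto intro: AE_I2 simp: dim_at_def)
  with conditional_measures_unique[OF PB sJ \<Theta>' joining_conditional_measures]
    conditional_measures_unique[OF PB sX \<Phi>' \<Phi>] AE_proximal_return[OF prox \<Psi> B]
  show "AE b in fam B 0 0. iso_mod_null (\<Theta>' b) (\<Phi>' b) fst"
  proof eventually_elim
    case (elim b)
    then show ?case
      using iso_mod_null_pair_return[OF conditional_measuresD(4)[OF \<Phi>]] by auto
  qed
qed

text \<open>The conditional measures of \<open>X\<close> are the values of the factor map \<open>\<pi>\<close>, averaged over \<open>\<Psi>\<close>: both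
  kernels have the translates of the measures of \<open>X\<close> as barycenters.\<close>

lemma conditional_measures_via_factor:
  assumes PB: "poisson_boundary G l \<sigma> B" and sX: "standard_borel (alg X)"
    and \<pi>: "factor_map G l Y (Pi_system B X \<Phi>) \<pi>"
  shows "AE b in fam B 0 0. \<Phi> b = Giry_Monad.bind (\<Psi> b) \<pi>"
proof (rule kernel_unique[OF PB sX conditional_measuresD(1)[OF \<Phi>]])
  have \<pi>_meas: "\<pi> \<in> measurable (alg Y) (prob_algebra (alg X))"
    and \<pi>_equiv: "\<And>g. g \<in> carrier G \<Longrightarrow> AE y in fam Y 0 0. \<pi> (act Y g y) = translate X g (\<pi> y)"
    and \<pi>_distr: "\<And>k j. j < dim_at l k \<Longrightarrow>
      distr (fam Y k j) (prob_algebra (alg X)) \<pi> = distr (fam B k j) (prob_algebra (alg X)) \<Phi>"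
    using \<pi> by (auto simp: factor_map_def G_map_def Pi_system_def)
  show "(\<lambda>b. Giry_Monad.bind (\<Psi> b) \<pi>) \<in> measurable (alg B) (prob_algebra (alg X))"
    using conditional_measuresD(1)[OF \<Psi>] \<pi>_meas by (rule measurable_bind_prob_space)
  fix k j g assume j: "j < dim_at l k" and g: "g \<in> carrier G"
  have \<Phi>m: "\<Phi> \<in> measurable (fam B k j) (prob_algebra (alg X))"
    using conditional_measuresD(1)[OF \<Phi>] sigma_systemD(3)[OF B j] by (simp cong: measurable_cong_sets)
  have \<pi>m: "\<pi> \<in> measurable (fam Y k j) (prob_algebra (alg X))"
    using \<pi>_meas sigma_systemD(3)[OF Y j] by (simp cong: measurable_cong_sets)
  have id: "(\<lambda>M. M) \<in> measurable (prob_algebra (alg X)) (subprob_algebra (alg X))"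
    by (rule measurable_prob_algebraD) simp
  have neB: "space (fam B k j) \<noteq> {}" and neY: "space (fam Y k j) \<noteq> {}"
    using prob_space.not_empty[OF sigma_systemD(2)[OF B j]] prob_space.not_empty[OF sigma_systemD(2)[OF Y j]] .
  \<comment> \<open>Both sides are the barycenter of the same measure on the space of measures, the one of the
     system of conditional measures.\<close>
  have barycenter: "Giry_Monad.bind (fam Y k j) \<pi> = fam X k j"
    using bind_distr[OF \<pi>m id neY] bind_distr[OF \<Phi>m id neB] \<pi>_distr[OF j]
      conditional_measures_bind[OF B X \<Phi> j] by simp
  have "Giry_Monad.bind (translate B g (fam B k j)) (\<lambda>b. Giry_Monad.bind (\<Psi> b) \<pi>) =
      Giry_Monad.bind (Giry_Monad.bind (translate B g (fam B k j)) \<Psi>) \<pi>"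
    using measurable_prob_algebraD[OF conditional_measuresD(1)[OF \<Psi>]] measurable_prob_algebraD[OF \<pi>_meas]
    by (intro bind_assoc[symmetric]) (simp_all cong: measurable_cong_sets)
  also have "\<dots> = Giry_Monad.bind (translate Y g (fam Y k j)) \<pi>"
    using conditional_measuresD(3)[OF \<Psi> j g] by simp
  also have "\<dots> = Giry_Monad.bind (fam Y k j) (\<lambda>y. \<pi> (act Y g y))"
    using bind_distr[OF act_measurable_fam[OF Y j g] measurable_prob_algebraD[OF \<pi>_meas] neY] .
  also have "\<dots> = Giry_Monad.bind (fam Y k j) (\<lambda>y. translate X g (\<pi> y))"
  proof (rule bind_cong_AE'[OF sigma_systemD(5)[OF Y j]])
    show "(\<lambda>y. \<pi> (act Y g y)) \<in> measurable (alg Y) (prob_algebra (alg X))"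
      using measurable_compose[OF measurable_actionD(1)[OF sigma_systemD(1)[OF Y] g] \<pi>_meas] .
    show "(\<lambda>y. translate X g (\<pi> y)) \<in> measurable (alg Y) (prob_algebra (alg X))"
      using \<pi>_meas measurable_distr_prob_space[OF measurable_actionD(1)[OF sigma_systemD(1)[OF X] g]]
      by (rule measurable_compose)
    show "AE y in fam Y k j. \<pi> (act Y g y) = translate X g (\<pi> y)"
      using AE_fam[OF Y \<pi>_equiv[OF g] j] .
  qed
  also have "\<dots> = translate X g (Giry_Monad.bind (fam Y k j) \<pi>)"
    using distr_bind[OF measurable_prob_algebraD[OF \<pi>m] neY measurable_actionD(1)[OF sigma_systemD(1)[OF X] g]]
    by simp
  also have "\<dots> = Giry_Monad.bind (translate B g (fam B k j)) \<Phi>"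
    using conditional_measuresD(3)[OF \<Phi> j g] barycenter by simp
  finally show "Giry_Monad.bind (translate B g (fam B k j)) \<Phi> =
      Giry_Monad.bind (translate B g (fam B k j)) (\<lambda>b. Giry_Monad.bind (\<Psi> b) \<pi>)" by simp
qed

text \<open>If moreover \<open>Y\<close> is proximal, then all translates of the measures of the joining arise from those of
  \<open>Y\<close> by one and the same kernel, whose value at \<open>y\<close> is concentrated on the fibre over \<open>y\<close>.\<close>

lemma translate_joining_via_factor:
  assumes PB: "poisson_boundary G l \<sigma> B" and sX: "standard_borel (alg X)"
    and prox: "proximal_system G l \<sigma> B Y" and \<pi>: "factor_map G l Y (Pi_system B X \<Phi>) \<pi>"
    and j: "j < dim_at l k" and g: "g \<in> carrier G"
  defines "K \<equiv> \<lambda>y. \<pi> y \<Otimes>\<^sub>M return (alg Y) y"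
  shows "translate J g (fam J k j) = Giry_Monad.bind (translate Y g (fam Y k j)) K"
proof -
  have \<pi>_meas: "\<pi> \<in> measurable (alg Y) (prob_algebra (alg X))"
    using \<pi> by (auto simp: factor_map_def G_map_def Pi_system_def)
  have K: "K \<in> measurable (alg Y) (prob_algebra (alg J))"
    unfolding K_def joining_sel by (intro measurable_pair_prob \<pi>_meas measurable_return_prob_space)
  have "AE b in fam B 0 0. \<Theta> b = Giry_Monad.bind (\<Psi> b) K"
    using conditional_measures_via_factor[OF PB sX \<pi>] AE_proximal_return[OF prox \<Psi> B]
  proof eventually_elim
    case (elim b)
    then obtain y where y: "y \<in> space (alg Y)" "\<Psi> b = return (alg Y) y" by blast
    then show ?case
      using elim(1) bind_return[OF measurable_prob_algebraD[OF \<pi>_meas] y(1)]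
        bind_return[OF measurable_prob_algebraD[OF K] y(1)] by (simp add: K_def)
  qed
  then have ae: "AE b in translate B g (fam B k j). \<Theta> b = Giry_Monad.bind (\<Psi> b) K"
    by (rule AE_translate[OF B _ j g])
  have "translate J g (fam J k j) = Giry_Monad.bind (translate B g (fam B k j)) \<Theta>"
    by (rule translate_joining[OF j g])
  also have "\<dots> = Giry_Monad.bind (translate B g (fam B k j)) (\<lambda>b. Giry_Monad.bind (\<Psi> b) K)"
    using \<Theta>_measurable measurable_bind_prob_space[OF conditional_measuresD(1)[OF \<Psi>] K]
    by (intro bind_cong_AE'[OF translate_in_prob_algebra[OF B j g] _ _ ae]) simp_all
  also have "\<dots> = Giry_Monad.bind (Giry_Monad.bind (translate B g (fam B k j)) \<Psi>) K"
    using measurable_prob_algebraD[OF conditional_measuresD(1)[OF \<Psi>]] measurable_prob_algebraD[OF K]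
    by (intro bind_assoc[symmetric]) (simp_all cong: measurable_cong_sets)
  also have "\<dots> = Giry_Monad.bind (translate Y g (fam Y k j)) K"
    using conditional_measuresD(3)[OF \<Psi> j g] by simp
  finally show ?thesis .
qed

text \<open>A density \<open>r\<close> on \<open>Y\<close> becomes \<open>r \<circ> snd\<close> on the joining, since \<open>r \<circ> snd\<close> is constant almost everywhere
  for each measure \<open>\<pi> y \<times> \<delta>\<^sub>y\<close>.\<close>

lemma snd_measure_preserving:
  assumes PB: "poisson_boundary G l \<sigma> B" and sX: "standard_borel (alg X)"
    and prox: "proximal_system G l \<sigma> B Y" and \<pi>: "factor_map G l Y (Pi_system B X \<Phi>) \<pi>"
  shows "measure_preserving_extension G l \<sigma> J Y snd"
  unfolding measure_preserving_extension_def
proof (intro conjI allI impI ballI)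
  show "sigma_system G l \<sigma> J" "sigma_system G l \<sigma> Y" "factor_map G l J Y snd"
    by (rule joining_sigma_system Y snd_factor)+
  fix k i g assume i: "i < dim_at l k" and g: "g \<in> carrier G"
  have d0: "0 < dim_at l 0" by (simp add: dim_at_def)
  define K where "K = (\<lambda>y. \<pi> y \<Otimes>\<^sub>M return (alg Y) y)"
  have \<pi>_meas: "\<pi> \<in> measurable (alg Y) (prob_algebra (alg X))"
    using \<pi> by (auto simp: factor_map_def G_map_def Pi_system_def)
  have K: "K \<in> measurable (alg Y) (prob_algebra (alg J))"
    unfolding K_def joining_sel by (intro measurable_pair_prob \<pi>_meas measurable_return_prob_space)
  let ?L = "fam Y 0 0" and ?L' = "translate Y g (fam Y k i)"
  let ?\<nu> = "fam J 0 0" and ?\<nu>' = "translate J g (fam J k i)"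
  interpret L: prob_space ?L using sigma_systemD(2)[OF Y d0] .
  interpret N: prob_space ?\<nu> using sigma_systemD(2)[OF joining_sigma_system d0] .
  have \<nu>': "?\<nu>' = Giry_Monad.bind ?L' K"
    unfolding K_def by (rule translate_joining_via_factor[OF PB sX prox \<pi> i g])
  have \<nu>: "?\<nu> = Giry_Monad.bind ?L K"
    using translate_joining_via_factor[OF PB sX prox \<pi> d0 one_closed]
    unfolding K_def translate_one[OF Y d0] translate_one[OF joining_sigma_system d0] .
  define r where "r = RN_deriv ?L ?L'"
  have r: "r \<in> borel_measurable ?L" "r \<in> borel_measurable (alg Y)"
    using sigma_systemD(3)[OF Y d0] borel_measurable_RN_deriv[of ?L ?L']
    by (simp_all add: r_def cong: measurable_cong_sets)
  have density_r: "density ?L r = ?L'"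
    unfolding r_def
  proof (rule L.density_RN_deriv)
    show "absolutely_continuous ?L ?L'"
      using translate_null[OF Y _ _ i g] sigma_systemD(3)[OF Y d0]
      by (auto simp: absolutely_continuous_def null_sets_def)
    show "sets ?L' = sets ?L" using sigma_systemD(3)[OF Y d0] by simp
  qed
  have m: "(\<lambda>z. r (snd z)) \<in> borel_measurable (alg J)"
    using measurable_compose[OF measurable_snd r(2)] by simp
  have "density ?\<nu> (\<lambda>z. r (snd z)) = ?\<nu>'"
  proof (rule measure_eqI)
    show "sets (density ?\<nu> (\<lambda>z. r (snd z))) = sets ?\<nu>'"
      using sigma_systemD(3)[OF joining_sigma_system d0] by simp
    fix A assume "A \<in> sets (density ?\<nu> (\<lambda>z. r (snd z)))"
    then have A: "A \<in> sets (alg J)" using sigma_systemD(3)[OF joining_sigma_system d0] by simp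
    have KL: "K \<in> measurable ?L (subprob_algebra (alg J))"
      using measurable_prob_algebraD[OF K] sigma_systemD(3)[OF Y d0] by (simp cong: measurable_cong_sets)
    have rA: "(\<lambda>z. r (snd z) * indicator A z) \<in> borel_measurable (alg J)"
      using m A by simp
    have KA: "(\<lambda>y. emeasure (K y) A) \<in> borel_measurable ?L"
      using measurable_compose[OF KL measurable_emeasure_subprob_algebra[OF A]] .
    have "emeasure (density ?\<nu> (\<lambda>z. r (snd z))) A = (\<integral>\<^sup>+z. r (snd z) * indicator A z \<partial>?\<nu>)"
      using m A sigma_systemD(3)[OF joining_sigma_system d0]
      by (intro emeasure_density) (simp_all cong: measurable_cong_sets)
    also have "\<dots> = (\<integral>\<^sup>+y. \<integral>\<^sup>+z. r (snd z) * indicator A z \<partial>K y \<partial>?L)"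
      unfolding \<nu> by (rule nn_integral_bind[OF rA KL])
    also have "\<dots> = (\<integral>\<^sup>+y. r y * emeasure (K y) A \<partial>?L)"
    proof (rule nn_integral_cong)
      fix y assume "y \<in> space ?L"
      then have y: "y \<in> space (alg Y)" using sigma_systemD(4)[OF Y d0] by simp
      have \<pi>y: "prob_space (\<pi> y)" "sets (\<pi> y) = sets (alg X)"
        using measurable_space[OF \<pi>_meas y] by (auto simp: space_prob_algebra)
      have sets_pair: "sets (\<pi> y \<Otimes>\<^sub>M alg Y) = sets (alg J)"
        using \<pi>y(2) by (simp cong: sets_pair_measure_cong)
      have sets_K: "sets (K y) = sets (alg J)"
        using measurable_space[OF K y] by (simp add: space_prob_algebra)
      have mA: "(\<lambda>x. indicator A (x, y)) \<in> borel_measurable (\<pi> y)"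
      proof -
        have "indicator A \<in> borel_measurable (\<pi> y \<Otimes>\<^sub>M alg Y)"
          using A unfolding sets_pair[symmetric] by (rule borel_measurable_indicator)
        then show ?thesis by (rule measurable_compose[OF measurable_Pair2'[OF y]])
      qed
      have "(\<integral>\<^sup>+z. r (snd z) * indicator A z \<partial>K y) = (\<integral>\<^sup>+x. r y * indicator A (x, y) \<partial>\<pi> y)"
        unfolding K_def using rA sets_pair
        by (subst nn_integral_pair_return[OF \<pi>y(1) y]) (simp_all cong: measurable_cong_sets)
      also have "\<dots> = r y * (\<integral>\<^sup>+x. indicator A (x, y) \<partial>\<pi> y)"
        by (rule nn_integral_cmult[OF mA])
      also have "(\<integral>\<^sup>+x. indicator A (x, y) \<partial>\<pi> y) = (\<integral>\<^sup>+z. indicator A z \<partial>K y)"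
        unfolding K_def using A sets_pair
        by (subst nn_integral_pair_return[OF \<pi>y(1) y]) (simp_all cong: measurable_cong_sets)
      also have "\<dots> = emeasure (K y) A"
        using A sets_K by simp
      finally show "(\<integral>\<^sup>+z. r (snd z) * indicator A z \<partial>K y) = r y * emeasure (K y) A" .
    qed
    also have "\<dots> = (\<integral>\<^sup>+y. emeasure (K y) A \<partial>density ?L r)"
      by (rule nn_integral_density[OF r(1) KA, symmetric])
    also have "\<dots> = emeasure ?\<nu>' A"
      unfolding density_r \<nu>'
      by (rule emeasure_bind_prob_algebra[OF translate_in_prob_algebra[OF Y i g] K A, symmetric])
    finally show "emeasure (density ?\<nu> (\<lambda>z. r (snd z))) A = emeasure ?\<nu>' A" .
  qed
  then have "AE z in ?\<nu>. r (snd z) = RN_deriv ?\<nu> ?\<nu>' z"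
    using m sigma_systemD(3)[OF joining_sigma_system d0]
    by (intro N.RN_deriv_unique) (simp_all cong: measurable_cong_sets)
  then show "AE z in ?\<nu>. RN_deriv ?\<nu> ?\<nu>' z = RN_deriv ?L ?L' (snd z)"
    unfolding r_def by eventually_elim (rule sym)
qed

end

theorem theoremB2p23:
  fixes G :: "('g, 'r) monoid_scheme"
    and l :: "nat \<Rightarrow> nat"
    and \<sigma> :: "nat \<Rightarrow> nat \<Rightarrow> nat \<Rightarrow> 'g measure"
    and B :: "('g, 'b) gsystem"
    and X :: "('g, 'x) gsystem"
    and \<Lambda> :: "('g, 'y) gsystem"
    and \<Phi> :: "'b \<Rightarrow> 'x measure"
    and \<Psi> :: "'b \<Rightarrow> 'y measure"
  assumes "group G" and "countable (carrier G)"
    and "stochastic_sequence G l \<sigma>"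
    and "\<And>j g. j < l 0 \<Longrightarrow> g \<in> carrier G \<Longrightarrow> 0 < emeasure (\<sigma> 0 0 j) {g}"
    and "no_zero_columns G l \<sigma>"
    and "poisson_boundary G l \<sigma> B"
    and "regular_system G l \<sigma> X"
    and "conditional_measures G l B X \<Phi>"
    and "proximal_system G l \<sigma> B \<Lambda>"
    and "\<exists>\<pi>. factor_map G l \<Lambda> (Pi_system B X \<Phi>) \<pi>"
    and "conditional_measures G l B \<Lambda> \<Psi>"
  shows "proximal_extension G l \<sigma> B (joining B X \<Phi> \<Lambda> \<Psi>) X fst \<and>
         measure_preserving_extension G l \<sigma> (joining B X \<Phi> \<Lambda> \<Psi>) \<Lambda> snd"
proof -
  have regular: "regular_system G l \<sigma> \<Lambda>"
    using assms(9) by (simp add: proximal_system_def proximal_extension_def)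
  interpret group G by fact
  interpret joined_systems G l \<sigma> B X \<Lambda> \<Phi> \<Psi>
    using assms regular by unfold_locales (auto simp: regular_system_def poisson_boundary_def)
  have "standard_borel (alg X)" "standard_borel (alg \<Lambda>)"
    using assms(7) regular by (simp_all add: regular_system_def)
  then show ?thesis
    using fst_proximal snd_measure_preserving assms(6,9,10) by blast
qed

end
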